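(* Consider $\min_{\mathbf{x}\in\mathbb{R}^d}F(\mathbf{x})=f(\mathbf{x})+r(\mathbf{x})$ with $f(\mathbf{x})=\mathbb{E}_\xi[f(\mathbf{x};\xi)]$, where $r:\mathbb{R}^d\to\mathbb{R}\cup\{+\infty\}$ is proper and lower-semicontinuous (possibly non-smooth, non-convex). Assume: (i) $\mathbb{E}_\xi[\nabla f(\mathbf{x};\xi)]=\nabla f(\mathbf{x})$ and $\mathbb{E}_\xi[\|\nabla f(\mathbf{x};\xi)-\nabla f(\mathbf{x})\|^2]\le\sigma^2$ for all $\mathbf{x}$, for some $\sigma>0$; (ii) $F(\mathbf{x}_0)-F(\mathbf{x}_* )\le\Delta$ with $0<\Delta<\infty$ for the initial point $\mathbf{x}_0$, where $\mathbf{x}_*$ is a global minimizer of $F$; (iii) $f$ is differentiable and $\|\nabla f(\mathbf{x})-\nabla f(\mathbf{y})\|\le L\|\mathbf{x}-\mathbf{y}\|$ for all $\mathbf{x},\mathbf{y}$, for some $L>0$. Let $\eta=\frac{c}{L}$ with $0<c<\frac12$, assume $\mathrm{prox}_{\eta r}[\mathbf{x}]\ne\emptyset$ for every $\mathbf{x}$, and put $c_1=\frac{2c(1-2c)+2}{c(1-2c)}$, $c_2=\frac{6-4c}{1-2c}$. Let $\epsilon>0$. Run algorithm MB-SPG (defined in the context) with $T=\lceil 2c_2\Delta/(\eta\epsilon^2)\rceil$ and fixed mini-batch size $m_t=\lceil 2c_1\sigma^2/\epsilon^2\rceil$ for $t=0,\dots,T-1$. Then the output satisfies $$\mathbb{E}\big[\mathrm{dist}(0,\hat\partial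 F(\mathbf{x}_R))^2\big]\le\epsilon^2 .$$ In particular, to have $\mathbb{E}[\mathrm{dist}(0,\hat\partial F(\mathbf{x}_R))]\le\epsilon$ it suffices to take $T=O(1/\epsilon^2)$ iterations, and the total complexity (total number $\sum_{t=0}^{T-1}m_t$ of stochastic gradients computed) is $O(1/\epsilon^4)$.
   Context: Algorithm MB-SPG (mini-batch stochastic proximal gradient): starting from $\mathbf{x}_0$, for $t=0,\dots,T-1$ draw $m_t$ fresh i.i.d. samples $\xi_1,\dots,\xi_{m_t}$ of $\xi$, independent of the past, set $\mathbf{g}_t=\frac{1}{m_t}\sum_{i=1}^{m_t}\nabla f(\mathbf{x}_t;\xi_i)$, and choose $\mathbf{x}_{t+1}\in\mathrm{prox}_{\eta r}[\mathbf{x}_t-\eta\mathbf{g}_t]$ (the iterates being random variables). Output $\mathbf{x}_R$ with $R$ uniform on $\{1,\dots,T\}$, independent of everything else. $\|\cdot\|$ is the Euclidean norm; $\mathrm{prox}_{\eta r}[\mathbf{x}]=\arg\min_{\mathbf{y}\in\mathbb{R}^d}\frac{1}{2\eta}\|\mathbf{y}-\mathbf{x}\|^2+r(\mathbf{y})$ (set of minimizers). For $h:\mathbb{R}^d\to\mathbb{R}\cup\{+\infty\}$ and $\bar{\mathbf{x}}$ with $h(\bar{\mathbf{x}})$ finite, the Fréchet subgradient set is $\hat\partial h(\bar{\mathbf{x}})=\{\mathbf{v}\in\mathbb{R}^d:\liminf_{\mathbf{x}\to\bar{\mathbf{x}},\,\mathbf{x}\ne\bar{\mathbf{x}}}\frac{h(\mathbf{x})-h(\bar{\mathbf{x}})-\mathbf{v}^\top(\mathbf{x}-\bar{\mathbf{x}})}{\|\mathbf{x}-\bar{\mathbf{x}}\|}\ge0\}$.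 $\mathrm{dist}(0,S)=\inf_{\mathbf{v}\in S}\|\mathbf{v}\|$ (and $+\infty$ if $S=\emptyset$). Constants in $O(\cdot)$ depend only on $c,L,\Delta,\sigma$, as $\epsilon\to0$. *)

theory Defs
  imports "HOL-Probability.Probability"
begin

definition proper :: "('a \<Rightarrow> ereal) \<Rightarrow> bool" where
  "proper h \<longleftrightarrow> (\<forall>x. h x \<noteq> -\<infinity>) \<and> (\<exists>x. h x \<noteq> \<infinity>)"

definition lower_semicontinuous :: "('a::topological_space \<Rightarrow> ereal) \<Rightarrow> bool" where
  "lower_semicontinuous h \<longleftrightarrow> (\<forall>x. h x \<le> Liminf (at x) h)"

definition prox :: "real \<Rightarrow> ('a::real_normed_vector \<Rightarrow> ereal) \<Rightarrow> 'a \<Rightarrow> 'a set" where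
  "prox \<eta> r x =
    {y. is_arg_min (\<lambda>y. ereal (1 / (2 * \<eta>) * (norm (y - x))\<^sup>2) + r y) (\<lambda>_. True) y}"

text \<open>The subgradient set is only meaningful where \<open>h\<close> is finite; elsewhere it is taken to be empty.\<close>

definition frechet_subdiff :: "('a::real_inner \<Rightarrow> ereal) \<Rightarrow> 'a \<Rightarrow> 'a set" where
  "frechet_subdiff h x =
    {v. \<bar>h x\<bar> \<noteq> \<infinity> \<and>
        0 \<le> Liminf (at x) (\<lambda>y. (h y - h x - ereal (v \<bullet> (y - x))) / ereal (norm (y - x)))}"

text \<open>Unlike \<^const>\<open>infdist\<close>, the distance to the empty set is infinite.\<close>

definition dist_zero :: "'a::real_normed_vector set \<Rightarrow> ennreal" where
  "dist_zero S = (INF v\<in>S. ennreal (norm v))"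

text \<open>
  Measurability of \<open>x \<mapsto> dist_zero (frechet_subdiff F x)\<close> is not part of the hypotheses, and
  \<^const>\<open>nn_integral\<close> is only a lower integral on non-measurable functions. A bound on the
  expectation is therefore stated for the upper integral, which is the ordinary expectation
  on measurable functions and dominates \<^const>\<open>nn_integral\<close> on all functions.
\<close>

definition upper_expectation :: "'w measure \<Rightarrow> ('w \<Rightarrow> ennreal) \<Rightarrow> ennreal" where
  "upper_expectation M X =
    (INF g\<in>{g \<in> borel_measurable M. \<forall>\<omega>\<in>space M. X \<omega> \<le> g \<omega>}. \<integral>\<^sup>+\<omega>. g \<omega> \<partial>M)"

lemma nn_integral_le_upper_expectation: "(\<integral>\<^sup>+\<omega>. X \<omega> \<partial>M) \<le> upper_expectation M X"
  unfolding upper_expectation_def by (intro INF_greatest nn_integral_mono) auto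

lemma upper_expectation_eq_nn_integral:
  assumes "X \<in> borel_measurable M"
  shows "upper_expectation M X = (\<integral>\<^sup>+\<omega>. X \<omega> \<partial>M)"
proof (rule antisym)
  show "upper_expectation M X \<le> (\<integral>\<^sup>+\<omega>. X \<omega> \<partial>M)"
    unfolding upper_expectation_def using assms by (intro INF_lower) auto
qed (rule nn_integral_le_upper_expectation)

text \<open>
  \<open>D\<close> is the distribution of the random datum, \<open>\<xi> t i\<close> is the \<open>i\<close>-th sample drawn in iteration \<open>t\<close>
  (\<open>i < m t\<close>) and \<open>x t\<close> is the \<open>t\<close>-th iterate. \<open>past_events\<close> collects what is determined by the
  iterates up to \<open>x t\<close> and the samples drawn before iteration \<open>t\<close>; the iterates have to be
  included because the selection of a proximal point may itself be randomized.
\<close>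

definition past_events ::
  "'w measure \<Rightarrow> 's measure \<Rightarrow> (nat \<Rightarrow> nat) \<Rightarrow> (nat \<Rightarrow> nat \<Rightarrow> 'w \<Rightarrow> 's) \<Rightarrow>
   (nat \<Rightarrow> 'w \<Rightarrow> 'a::topological_space) \<Rightarrow> nat \<Rightarrow> 'w set set" where
  "past_events M D m \<xi> x t = sigma_sets (space M)
    ({x s -` A \<inter> space M | s A. s \<le> t \<and> A \<in> sets borel} \<union>
     {\<xi> s i -` A \<inter> space M | s i A. s < t \<and> i < m s \<and> A \<in> sets D})"

definition batch_events ::
  "'w measure \<Rightarrow> 's measure \<Rightarrow> (nat \<Rightarrow> nat) \<Rightarrow> (nat \<Rightarrow> nat \<Rightarrow> 'w \<Rightarrow> 's) \<Rightarrow> nat \<Rightarrow> 'w set set" where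
  "batch_events M D m \<xi> t = sigma_sets (space M)
    {\<xi> t i -` A \<inter> space M | i A. i < m t \<and> A \<in> sets D}"

locale mb_spg = prob_space M
  for M :: "'w measure"
    and D :: "'s measure"
    and grad :: "'a::euclidean_space \<Rightarrow> 's \<Rightarrow> 'a"
    and r :: "'a \<Rightarrow> ereal"
    and \<eta> :: real
    and x0 :: 'a
    and T :: nat
    and m :: "nat \<Rightarrow> nat"
    and \<xi> :: "nat \<Rightarrow> nat \<Rightarrow> 'w \<Rightarrow> 's"
    and x :: "nat \<Rightarrow> 'w \<Rightarrow> 'a"
    and R :: "'w \<Rightarrow> nat" +
  assumes iterate_measurable: "t \<le> T \<Longrightarrow> random_variable borel (x t)"
    and init: "\<omega> \<in> space M \<Longrightarrow> x 0 \<omega> = x0"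
    and step: "t < T \<Longrightarrow> \<omega> \<in> space M \<Longrightarrow>
      x (Suc t) \<omega> \<in> prox \<eta> r
        (x t \<omega> - \<eta> *\<^sub>R ((1 / real (m t)) *\<^sub>R (\<Sum>i<m t. grad (x t \<omega>) (\<xi> t i \<omega>))))"
    and sample_distr: "t < T \<Longrightarrow> i < m t \<Longrightarrow> random_variable D (\<xi> t i) \<and> distr M D (\<xi> t i) = D"
    and sample_indep: "t < T \<Longrightarrow> indep_vars (\<lambda>_. D) (\<xi> t) {..<m t}"
    and fresh: "t < T \<Longrightarrow> indep_set (past_events M D m \<xi> x t) (batch_events M D m \<xi> t)"
    and output_measurable: "random_variable (count_space UNIV) R"
    and output_uniform: "distr M (count_space UNIV) R = measure_pmf (pmf_of_set {1..T})"
    and output_indep: "indep_set {R -` A \<inter> space M | A. A \<in> UNIV} (past_events M D m \<xi> x T)"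

end

theory Submission
  imports Defs
begin

text \<open>
  Each proximal step produces the Frechet subgradient
  \<open>v t = grad_f (x (t + 1)) - (x (t + 1) - (x t - \<eta> g t)) / \<eta>\<close> of \<open>F\<close> at \<open>x (t + 1)\<close>.
  Comparing the proximal objective at \<open>x (t + 1)\<close> and \<open>x t\<close> and using the descent lemma for \<open>f\<close>,
  \<open>(norm (v t))\<^sup>2\<close> is at most \<open>c1\<close> times the squared gradient error plus \<open>c2 / \<eta>\<close> times the
  decrease of \<open>F\<close>. The decreases telescope for every sample path, so only the gradient error has to be
  integrated; a batch of size \<open>m\<close> that is independent of \<open>x t\<close> makes it at most \<open>\<sigma>\<^sup>2 / m\<close>.
  Integrating out \<open>x t\<close> needs joint measurability of the stochastic gradient, which holds because
  it is a limit of difference quotients of functions continuous in \<open>x\<close> and measurable in the datum.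
\<close>

section \<open>Proximal steps\<close>

lemma norm_add_square:
  fixes a b :: "'a::real_inner"
  shows "(norm (a + b))\<^sup>2 = (norm a)\<^sup>2 + 2 * (a \<bullet> b) + (norm b)\<^sup>2"
  by (simp add: power2_norm_eq_inner inner_add inner_commute)

text \<open>Along the segment from \<open>x\<close> to \<open>y\<close>, \<open>\<phi>\<close>
  subtracts from \<open>f\<close> the linear and quadratic terms of the bound. By Cauchy-Schwarz and
  the Lipschitz condition its derivative is nonpositive for \<open>s \<ge> 0\<close>, so comparing
  \<open>s = 0\<close> with \<open>s = 1\<close> gives the claim without integrating the
  gradient.\<close>

lemma descent_lemma:
  fixes f :: "'a::real_inner \<Rightarrow> real"
  assumes "\<And>x. GDERIV f x :> gf x" "\<And>x y. norm (gf x - gf y) \<le> L * norm (x - y)"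
  shows "f y \<le> f x + gf x \<bullet> (y - x) + L / 2 * (norm (y - x))\<^sup>2"
proof -
  define d where "d = y - x"
  define \<phi> where "\<phi> s = f (x + s *\<^sub>R d) - s * (gf x \<bullet> d) - L / 2 * s\<^sup>2 * (norm d)\<^sup>2" for s
  have deriv: "(\<phi> has_real_derivative (gf (x + s *\<^sub>R d) - gf x) \<bullet> d - L * s * (norm d)\<^sup>2) (at s)" for s
  proof -
    have "((\<lambda>s. x + s *\<^sub>R d) has_derivative (\<lambda>h. h *\<^sub>R d)) (at s)"
      by (auto intro!: derivative_eq_intros)
    moreover have "(f has_derivative (\<lambda>h. h \<bullet> gf (x + s *\<^sub>R d))) (at (x + s *\<^sub>R d))"
      using assms(1) by (simp add: gderiv_def)
    ultimately have "((\<lambda>s. f (x + s *\<^sub>R d)) has_derivative (\<lambda>h. h *\<^sub>R d \<bullet> gf (x + s *\<^sub>R d))) (at s)"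
      by (rule has_derivative_compose)
    then have "((\<lambda>s. f (x + s *\<^sub>R d)) has_real_derivative gf (x + s *\<^sub>R d) \<bullet> d) (at s)"
      by (rule has_derivative_imp_has_field_derivative) (simp add: inner_commute mult.commute)
    then show ?thesis
      unfolding \<phi>_def by (auto intro!: derivative_eq_intros simp: inner_diff_left)
  qed
  have nonpos: "(gf (x + s *\<^sub>R d) - gf x) \<bullet> d - L * s * (norm d)\<^sup>2 \<le> 0" if "0 \<le> s" for s
  proof -
    have "(gf (x + s *\<^sub>R d) - gf x) \<bullet> d \<le> norm (gf (x + s *\<^sub>R d) - gf x) * norm d"
      by (rule norm_cauchy_schwarz)
    also have "\<dots> \<le> L * norm (x + s *\<^sub>R d - x) * norm d"
      by (intro mult_right_mono assms) auto
    finally show ?thesis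
      using that by (simp add: power2_eq_square mult_ac)
  qed
  have "\<phi> 1 \<le> \<phi> 0"
  proof (rule DERIV_nonpos_imp_nonincreasing[of 0 1 \<phi>])
    show "\<exists>l. (\<phi> has_real_derivative l) (at s) \<and> l \<le> 0" if "0 \<le> s" "s \<le> 1" for s
      using deriv nonpos[OF that(1)] by blast
  qed simp
  then show ?thesis
    by (simp add: \<phi>_def d_def)
qed

lemma proxD:
  "y \<in> prox \<eta> r z \<Longrightarrow>
    ereal (1 / (2 * \<eta>) * (norm (y - z))\<^sup>2) + r y \<le> ereal (1 / (2 * \<eta>) * (norm (u - z))\<^sup>2) + r u"
  by (auto simp: prox_def is_arg_min_def not_less)

text \<open>Minimality is tested against a point where \<open>r\<close> is finite; the proximal
  objective is finite there, so it cannot be infinite at \<open>y\<close>.\<close>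

lemma prox_finite:
  assumes "proper r" "y \<in> prox \<eta> r z"
  shows "\<bar>r y\<bar> \<noteq> \<infinity>"
proof -
  obtain u where "r u \<noteq> \<infinity>" using assms(1) by (auto simp: proper_def)
  with proxD[OF assms(2), of u] assms(1) show ?thesis
    unfolding proper_def by (cases "r u"; cases "r y") auto
qed

text \<open>Real-valued form of minimality: finiteness of \<open>r y\<close> allows the
  extended-real inequality to be rearranged.\<close>

lemma prox_le:
  assumes "proper r" "y \<in> prox \<eta> r z" "r u = ereal b"
  shows "real_of_ereal (r y) \<le> b + 1 / (2 * \<eta>) * ((norm (u - z))\<^sup>2 - (norm (y - z))\<^sup>2)"
  using proxD[OF assms(2), of u] prox_finite[OF assms(1,2)] assms(3)
  by (cases "r y") (auto simp: algebra_simps)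

text \<open>Minimality of \<open>y\<close> bounds \<open>r u - r y\<close> below by a linear term
  with slope \<open>- (1 / \<eta>) *\<^sub>R (y - z)\<close> and a term quadratic in
  \<open>norm (u - y)\<close>. Adding the first-order expansion of \<open>f\<close> leaves an error
  of smaller order than \<open>norm (u - y)\<close>.\<close>

lemma frechet_subdiff_prox:
  fixes f :: "'a::euclidean_space \<Rightarrow> real"
  assumes "GDERIV f y :> g" "proper r" "y \<in> prox \<eta> r z" "\<And>u. F u = ereal (f u) + r u"
  shows "g - (1 / \<eta>) *\<^sub>R (y - z) \<in> frechet_subdiff F y"
proof -
  define v where "v = g - (1 / \<eta>) *\<^sub>R (y - z)"
  obtain a where a: "r y = ereal a"
    using prox_finite[OF assms(2,3)] by auto
  \<comment> \<open>\<open>q\<close> is a finite minorant of the difference quotient of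
    \<open>F\<close> at every \<open>u\<close> other than \<open>y\<close>; since it tends to 0, the
    limit inferior of the quotient is nonnegative.\<close>
  define q where
    "q u = (f u - f y - g \<bullet> (u - y)) / norm (u - y) - 1 / (2 * \<eta>) * norm (u - y)" for u
  have "((\<lambda>u. (f u - f y - (u - y) \<bullet> g) / norm (u - y)) \<longlongrightarrow> 0) (at y)"
    using assms(1) unfolding gderiv_def has_derivative_iff_norm
    by (auto intro: tendsto_rabs_zero_cancel)
  moreover have "((\<lambda>u. 1 / (2 * \<eta>) * norm (u - y)) \<longlongrightarrow> 1 / (2 * \<eta>) * norm (y - y)) (at y)"
    by (intro tendsto_intros)
  ultimately have "(q \<longlongrightarrow> 0) (at y)"
    unfolding q_def using tendsto_diff by (fastforce simp: inner_commute)
  then have "Liminf (at y) (\<lambda>u. ereal (q u)) = 0"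
    by (intro lim_imp_Liminf) (auto simp: zero_ereal_def)
  moreover have "Liminf (at y) (\<lambda>u. ereal (q u)) \<le>
      Liminf (at y) (\<lambda>u. (F u - F y - ereal (v \<bullet> (u - y))) / ereal (norm (u - y)))"
  proof (rule Liminf_mono, unfold eventually_at_filter, rule always_eventually, intro allI impI)
    fix u assume "u \<noteq> y"
    then have pos: "norm (u - y) > 0" by simp
    show "ereal (q u) \<le> (F u - F y - ereal (v \<bullet> (u - y))) / ereal (norm (u - y))"
    proof (cases "r u")
      case (real b)
      \<comment> \<open>Expanding about \<open>y\<close> separates the cross term, which supplies
        the slope of the subgradient, from the square, which supplies the error in
        \<open>q\<close>.\<close>
      have eq: "(norm (u - z))\<^sup>2 - (norm (y - z))\<^sup>2 = (norm (u - y))\<^sup>2 + 2 * ((y - z) \<bullet> (u - y))"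
        by (simp add: power2_norm_eq_inner algebra_simps inner_commute)
      have "a \<le> b + 1 / (2 * \<eta>) * ((norm (u - y))\<^sup>2 + 2 * ((y - z) \<bullet> (u - y)))"
        using prox_le[OF assms(2,3) real] a unfolding eq by simp
      then have "a \<le> b + 1 / (2 * \<eta>) * (norm (u - y))\<^sup>2 + 1 / \<eta> * ((y - z) \<bullet> (u - y))"
        by (simp add: algebra_simps)
      then have "f u - f y - g \<bullet> (u - y) - 1 / (2 * \<eta>) * (norm (u - y))\<^sup>2
          \<le> f u + b - (f y + a) - v \<bullet> (u - y)"
        by (simp add: v_def inner_diff_left)
      then have "(f u - f y - g \<bullet> (u - y) - 1 / (2 * \<eta>) * (norm (u - y))\<^sup>2) / norm (u - y)
          \<le> (f u + b - (f y + a) - v \<bullet> (u - y)) / norm (u - y)"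
        by (rule divide_right_mono) simp
      moreover have "(f u - f y - g \<bullet> (u - y) - 1 / (2 * \<eta>) * (norm (u - y))\<^sup>2) / norm (u - y) = q u"
        using pos by (simp add: q_def diff_divide_distrib power2_eq_square)
      ultimately show ?thesis
        using pos by (simp add: assms(4) a real)
    next
      case PInf
      then show ?thesis using pos by (simp add: assms(4) a)
    next
      case MInf
      then show ?thesis using assms(2) by (auto simp: proper_def)
    qed
  qed
  ultimately show ?thesis
    using a unfolding frechet_subdiff_def v_def by (simp add: assms(4))
qed

lemma dist_zero_le: "v \<in> S \<Longrightarrow> dist_zero S \<le> ennreal (norm v)"
  unfolding dist_zero_def by (rule INF_lower)

text \<open>With gradient error \<open>e\<close>, step \<open>d\<close> and gradient change
  \<open>w\<close>, the subgradient is \<open>- ((e - w) + (1 / \<eta>) *\<^sub>R d)\<close>. The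
  inequality \<open>decrease\<close> is used twice: with Young's inequality it bounds the squared
  step \<open>N\<close>, and it bounds the cross term in the expanded square of the
  subgradient.\<close>

lemma proximal_step_bound:
  fixes f :: "'a::euclidean_space \<Rightarrow> real"
  assumes grad: "\<And>x. GDERIV f x :> gf x"
    and lip: "\<And>x y. norm (gf x - gf y) \<le> L * norm (x - y)"
    and "proper r" and L: "L > 0" and c: "0 < c" "c < 1 / 2" and \<eta>: "\<eta> = c / L"
    and y: "y \<in> prox \<eta> r (x - \<eta> *\<^sub>R g)" and rx: "r x = ereal a" and ry: "r y = ereal b"
  shows "(norm (gf y - (1 / \<eta>) *\<^sub>R (y - (x - \<eta> *\<^sub>R g))))\<^sup>2
    \<le> (2 * c * (1 - 2 * c) + 2) / (c * (1 - 2 * c)) * (norm (g - gf x))\<^sup>2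
      + (6 - 4 * c) / (1 - 2 * c) / \<eta> * ((f x + a) - (f y + b))"
proof -
  define d where "d = y - x"
  define e where "e = g - gf x"
  define w where "w = gf y - gf x"
  define \<Phi> where "\<Phi> = (f x + a) - (f y + b)"
  define N where "N = (norm d)\<^sup>2"
  define E where "E = (norm e)\<^sup>2"
  have \<eta>0: "\<eta> > 0" using L c \<eta> by simp
  have L\<eta>: "L = c / \<eta>" using L c \<eta> by simp
  have N0: "N \<ge> 0" by (simp add: N_def)
  \<comment> \<open>The proximal objective at \<open>y\<close> is compared with its value at the
    previous iterate \<open>x\<close>; the squares of \<open>\<eta> *\<^sub>R g\<close> then
    cancel.\<close>
  have "b \<le> a + 1 / (2 * \<eta>) * ((norm (x - (x - \<eta> *\<^sub>R g)))\<^sup>2 - (norm (y - (x - \<eta> *\<^sub>R g)))\<^sup>2)"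
    using prox_le[OF \<open>proper r\<close> y rx] ry by simp
  also have "(norm (x - (x - \<eta> *\<^sub>R g)))\<^sup>2 - (norm (y - (x - \<eta> *\<^sub>R g)))\<^sup>2 = (norm (\<eta> *\<^sub>R g))\<^sup>2 - (norm (d + \<eta> *\<^sub>R g))\<^sup>2"
    by (simp add: d_def algebra_simps)
  also have "\<dots> = - N - 2 * \<eta> * (g \<bullet> d)"
    unfolding N_def norm_add_square by (simp add: inner_commute)
  finally have "b \<le> a - N / (2 * \<eta>) - g \<bullet> d"
    using \<eta>0 by (simp add: field_simps)
  moreover have "f y \<le> f x + gf x \<bullet> d + L / 2 * N"
    using descent_lemma[OF grad lip, of y x] by (simp add: d_def N_def)
  ultimately have decrease: "e \<bullet> d \<le> \<Phi> - N / (2 * \<eta>) + L / 2 * N"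
    by (simp add: e_def \<Phi>_def inner_diff_left)
  have wN: "(norm w)\<^sup>2 \<le> L\<^sup>2 * N"
    using power_mono[OF lip[of y x], of 2] by (simp add: w_def N_def d_def power_mult_distrib)
  have wd: "\<bar>w \<bullet> d\<bar> \<le> L * N"
  proof -
    have "\<bar>w \<bullet> d\<bar> \<le> norm w * norm d" by (rule Cauchy_Schwarz_ineq2)
    also have "\<dots> \<le> L * norm d * norm d"
      using lip[of y x] by (intro mult_right_mono) (auto simp: w_def d_def)
    finally show ?thesis by (simp add: N_def power2_eq_square)
  qed
  \<comment> \<open>Young's inequality as a nonnegative square. The weight \<open>1 / L\<close>
    bounds \<open>- (e \<bullet> d)\<close> by \<open>E / (2 * L) + L / 2 * N\<close>, so that
    \<open>N\<close> keeps the factor \<open>1 / (2 * \<eta>) - L\<close>, which is positive because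
    \<open>c < 1 / 2\<close>.\<close>
  have "0 \<le> (norm ((1 / L) *\<^sub>R e + d))\<^sup>2" by simp
  also have "\<dots> = E / L\<^sup>2 + 2 / L * (e \<bullet> d) + N"
    unfolding E_def N_def norm_add_square by (simp add: power_divide)
  finally have "0 \<le> L / 2 * (E / L\<^sup>2 + 2 / L * (e \<bullet> d) + N)"
    using L by simp
  also have "\<dots> = E / (2 * L) + e \<bullet> d + L / 2 * N"
    using L by (simp add: field_simps power2_eq_square)
  finally have "N / (2 * \<eta>) - L * N \<le> \<Phi> + E / (2 * L)"
    using decrease by simp
  then have "(N / (2 * \<eta>) - L * N) * (2 * \<eta>) \<le> (\<Phi> + E / (2 * L)) * (2 * \<eta>)"
    using \<eta>0 by (intro mult_right_mono) auto
  moreover have "(N / (2 * \<eta>) - L * N) * (2 * \<eta>) = (1 - 2 * c) * N"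
    using \<eta>0 by (simp add: L\<eta> field_simps)
  moreover have "(\<Phi> + E / (2 * L)) * (2 * \<eta>) = 2 * \<eta> * \<Phi> + \<eta>\<^sup>2 / c * E"
    using \<eta>0 c by (simp add: L\<eta> field_simps power2_eq_square)
  ultimately have "(1 - 2 * c) * N \<le> 2 * \<eta> * \<Phi> + \<eta>\<^sup>2 / c * E" by simp
  then have N_le: "N \<le> (2 * \<eta> * \<Phi> + \<eta>\<^sup>2 / c * E) / (1 - 2 * c)"
    using c by (simp add: pos_le_divide_eq mult.commute)
  \<comment> \<open>The parallelogram identity, with the square of \<open>norm (e + w)\<close>
    dropped.\<close>
  have "(norm (e - w))\<^sup>2 \<le> 2 * E + 2 * (norm w)\<^sup>2"
  proof -
    have "(norm (e - w))\<^sup>2 + (norm (e + w))\<^sup>2 = 2 * E + 2 * (norm w)\<^sup>2"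
      unfolding E_def by (simp add: power2_norm_eq_inner algebra_simps inner_commute)
    then show ?thesis using zero_le_power2[of "norm (e + w)"] by linarith
  qed
  moreover have "gf y - (1 / \<eta>) *\<^sub>R (y - (x - \<eta> *\<^sub>R g)) = - ((e - w) + (1 / \<eta>) *\<^sub>R d)"
    using \<eta>0 by (simp add: e_def w_def d_def algebra_simps)
  then have "(norm (gf y - (1 / \<eta>) *\<^sub>R (y - (x - \<eta> *\<^sub>R g))))\<^sup>2
      = (norm (e - w))\<^sup>2 + 2 / \<eta> * (e \<bullet> d - w \<bullet> d) + N / \<eta>\<^sup>2"
    by (simp add: N_def norm_add_square power_divide inner_diff_left norm_minus_cancel
        del: minus_add_distrib)
  \<comment> \<open>Bounding \<open>e \<bullet> d\<close> by \<open>decrease\<close> instead of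
    Cauchy-Schwarz contributes \<open>- N / \<eta>\<^sup>2\<close>, which cancels the squared step
    in the expansion.\<close>
  moreover have "2 / \<eta> * (e \<bullet> d - w \<bullet> d) \<le> 2 / \<eta> * (\<Phi> - N / (2 * \<eta>) + L / 2 * N + L * N)"
    using decrease wd \<eta>0 by (intro mult_left_mono) auto
  ultimately have "(norm (gf y - (1 / \<eta>) *\<^sub>R (y - (x - \<eta> *\<^sub>R g))))\<^sup>2
      \<le> 2 * E + 2 * (L\<^sup>2 * N) + 2 / \<eta> * (\<Phi> - N / (2 * \<eta>) + L / 2 * N + L * N) + N / \<eta>\<^sup>2"
    using wN by linarith
  also have "\<dots> = 2 * E + 2 / \<eta> * \<Phi> + (2 * c\<^sup>2 + 3 * c) / \<eta>\<^sup>2 * N"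
    using \<eta>0 by (simp add: L\<eta> field_simps power2_eq_square)
  \<comment> \<open>For \<open>c < 1 / 2\<close> the coefficient
    \<open>2 * c\<^sup>2 + 3 * c\<close> is at most 2; this rounding leads to the two constants of
    the statement.\<close>
  also have "\<dots> \<le> 2 * E + 2 / \<eta> * \<Phi> + 2 / \<eta>\<^sup>2 * N"
  proof -
    have "c\<^sup>2 \<le> (1 / 2)\<^sup>2" using c by (intro power_mono) auto
    then have "2 * c\<^sup>2 + 3 * c \<le> 2" using c by (simp add: power2_eq_square)
    then show ?thesis
      using N0 by (intro add_left_mono mult_right_mono divide_right_mono) auto
  qed
  also have "\<dots> \<le> 2 * E + 2 / \<eta> * \<Phi> + 2 / \<eta>\<^sup>2 * ((2 * \<eta> * \<Phi> + \<eta>\<^sup>2 / c * E) / (1 - 2 * c))"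
    using N_le by (intro add_left_mono mult_left_mono) auto
  also have "\<dots> = (2 * c * (1 - 2 * c) + 2) / (c * (1 - 2 * c)) * E
      + (6 - 4 * c) / (1 - 2 * c) / \<eta> * \<Phi>"
  proof -
    define k where "k = 1 - 2 * c"
    have k: "k > 0" and eq: "6 - 4 * c = 2 * k + 4" using c by (simp_all add: k_def)
    show ?thesis
      unfolding k_def[symmetric] eq using \<eta>0 \<open>0 < c\<close> k
      by (simp add: field_simps power2_eq_square)
  qed
  finally show ?thesis by (simp add: E_def e_def \<Phi>_def)
qed

section \<open>Measurability and independence\<close>

text \<open>Simple functions \<open>q i\<close> converge pointwise to the identity. As
  \<open>q i\<close> takes finitely many values, \<open>h (q i x) s\<close> is jointly measurable,
  and continuity in \<open>x\<close> carries this to the limit.\<close>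

lemma caratheodory_measurable:
  fixes h :: "'a::{metric_space, second_countable_topology} \<Rightarrow> 's \<Rightarrow> 'b::metric_space"
  assumes meas: "\<And>x. h x \<in> borel_measurable D"
    and cont: "\<And>s. s \<in> space D \<Longrightarrow> continuous_on UNIV (\<lambda>x. h x s)"
  shows "(\<lambda>(x, s). h x s) \<in> borel_measurable (borel \<Otimes>\<^sub>M D)"
proof -
  obtain q :: "nat \<Rightarrow> 'a \<Rightarrow> 'a" where
    q: "\<And>i. simple_function borel (q i)" "\<And>x. (\<lambda>i. q i x) \<longlonglongrightarrow> x"
    using borel_measurable_implies_sequence_metric[of "\<lambda>x. x" borel undefined] by auto
  show ?thesis
  proof (rule borel_measurable_LIMSEQ_metric)
    fix i
    have fin: "finite (range (q i))" using q(1)[of i] by (simp add: simple_function_def)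
    have "q i \<in> measurable borel (count_space (range (q i)))"
      using simple_functionD(2)[OF q(1)] by (simp add: measurable_count_space_eq2[OF fin])
    then have "(\<lambda>p. q i (fst p)) \<in> measurable (borel \<Otimes>\<^sub>M D) (count_space (range (q i)))"
      by (rule measurable_compose[OF measurable_fst])
    moreover have "(\<lambda>p. h y (snd p)) \<in> borel_measurable (borel \<Otimes>\<^sub>M D)" for y
      by (rule measurable_compose[OF measurable_snd meas])
    ultimately show "(\<lambda>p. h (q i (fst p)) (snd p)) \<in> borel_measurable (borel \<Otimes>\<^sub>M D)"
      using countable_finite[OF fin]
      by (intro measurable_compose_countable'[where f = "\<lambda>y p. h y (snd p)"
            and g = "\<lambda>p. q i (fst p)" and I = "range (q i)"])
  next
    fix p assume "p \<in> space (borel \<Otimes>\<^sub>M D :: ('a \<times> 's) measure)"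
    then obtain x s where p: "p = (x, s)" "s \<in> space D"
      by (cases p) (auto simp: space_pair_measure)
    have "isCont (\<lambda>x. h x s) x"
      using cont[OF p(2)] by (simp add: continuous_on_eq_continuous_at)
    then have "(\<lambda>i. h (q i x) s) \<longlonglongrightarrow> h x s"
      using q(2)[of x] by (rule isCont_tendsto_compose)
    then show "(\<lambda>i. h (q i (fst p)) (snd p)) \<longlonglongrightarrow> (case p of (x, s) \<Rightarrow> h x s)"
      by (simp add: p)
  qed
qed

text \<open>The chain rule along a line, sampled at steps \<open>1 / Suc n\<close>: the directional
  derivative becomes the limit of a sequence, as measurability arguments require.\<close>

lemma GDERIV_difference_quotient:
  fixes f :: "'a::real_inner \<Rightarrow> real"
  assumes "GDERIV f x :> g"
  shows "(\<lambda>n. (f (x + (1 / real (Suc n)) *\<^sub>R b) - f x) * real (Suc n)) \<longlonglongrightarrow> g \<bullet> b"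
proof -
  have "((\<lambda>s. x + s *\<^sub>R b) has_derivative (\<lambda>h. h *\<^sub>R b)) (at 0)"
    by (auto intro!: derivative_eq_intros)
  moreover have "(f has_derivative (\<lambda>h. h \<bullet> g)) (at (x + 0 *\<^sub>R b))"
    using assms by (simp add: gderiv_def)
  ultimately have "((\<lambda>s. f (x + s *\<^sub>R b)) has_derivative (\<lambda>h. h *\<^sub>R b \<bullet> g)) (at 0)"
    by (rule has_derivative_compose)
  then have "((\<lambda>s. f (x + s *\<^sub>R b)) has_real_derivative g \<bullet> b) (at 0)"
    by (rule has_derivative_imp_has_field_derivative) (simp add: inner_commute mult.commute)
  then have "((\<lambda>s. (f (x + s *\<^sub>R b) - f x) / s) \<longlongrightarrow> g \<bullet> b) (at 0)"
    by (simp add: DERIV_def)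
  moreover have "filterlim (\<lambda>n. 1 / real (Suc n)) (at 0) sequentially"
    unfolding filterlim_at using LIMSEQ_inverse_real_of_nat by (auto simp: inverse_eq_divide)
  ultimately have "(\<lambda>n. (f (x + (1 / real (Suc n)) *\<^sub>R b) - f x) / (1 / real (Suc n))) \<longlonglongrightarrow> g \<bullet> b"
    by (rule filterlim_compose)
  then show ?thesis by simp
qed

text \<open>Differentiability makes \<open>h\<close> continuous in its first argument, hence jointly
  measurable; the gradient is then treated one component at a time.\<close>

lemma gradient_jointly_measurable:
  fixes h :: "'a::euclidean_space \<Rightarrow> 's \<Rightarrow> real"
  assumes meas: "\<And>x. h x \<in> borel_measurable D"
    and grad: "\<And>x s. s \<in> space D \<Longrightarrow> GDERIV (\<lambda>y. h y s) x :> g x s"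
  shows "(\<lambda>(x, s). g x s) \<in> borel_measurable (borel \<Otimes>\<^sub>M D)"
proof (subst borel_measurable_euclidean_space, intro ballI)
  have joint: "(\<lambda>(x, s). h x s) \<in> borel_measurable (borel \<Otimes>\<^sub>M D)"
  proof (rule caratheodory_measurable[OF meas])
    fix s assume "s \<in> space D"
    then show "continuous_on UNIV (\<lambda>x. h x s)"
      using grad unfolding gderiv_def
      by (intro has_derivative_continuous_on[of _ _ "\<lambda>x k. k \<bullet> g x s"])
        (auto simp: has_derivative_at_withinI)
  qed
  fix b :: 'a
  let ?q = "\<lambda>n p. (h (fst p + (1 / real (Suc n)) *\<^sub>R b) (snd p) - h (fst p) (snd p)) * real (Suc n)"
  show "(\<lambda>p. (case p of (x, s) \<Rightarrow> g x s) \<bullet> b) \<in> borel_measurable (borel \<Otimes>\<^sub>M D)"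
  proof (rule borel_measurable_LIMSEQ_metric[of ?q])
    have [measurable]: "(\<lambda>p. h (fst p + v) (snd p)) \<in> borel_measurable (borel \<Otimes>\<^sub>M D)" for v
      using measurable_compose[OF _ joint, of "\<lambda>p. (fst p + v, snd p)" "borel \<Otimes>\<^sub>M D"] by simp
    from this[of 0] have [measurable]: "(\<lambda>p. h (fst p) (snd p)) \<in> borel_measurable (borel \<Otimes>\<^sub>M D)"
      by simp
    show "?q n \<in> borel_measurable (borel \<Otimes>\<^sub>M D)" for n by measurable
    fix p assume "p \<in> space (borel \<Otimes>\<^sub>M D :: ('a \<times> 's) measure)"
    then have "snd p \<in> space D" by (auto simp: space_pair_measure)
    from GDERIV_difference_quotient[OF grad[OF this]]
    show "(\<lambda>n. ?q n p) \<longlonglongrightarrow> (case p of (x, s) \<Rightarrow> g x s) \<bullet> b" by (simp add: case_prod_beta)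
  qed
qed

section \<open>Second moments of independent sums, and a product rule under independence\<close>

context prob_space
begin

text \<open>After expanding the square, independence factors every off-diagonal expectation and
  centering makes it 0.\<close>

lemma expectation_sum_square_centered:
  fixes X :: "'i \<Rightarrow> 'a \<Rightarrow> real"
  assumes "finite I" and indep: "indep_vars (\<lambda>_. borel) X I"
    and int: "\<And>i. i \<in> I \<Longrightarrow> integrable M (X i)"
    and sq: "\<And>i. i \<in> I \<Longrightarrow> integrable M (\<lambda>\<omega>. (X i \<omega>)\<^sup>2)"
    and centered: "\<And>i. i \<in> I \<Longrightarrow> expectation (X i) = 0"
  shows "integrable M (\<lambda>\<omega>. (\<Sum>i\<in>I. X i \<omega>)\<^sup>2)"
    and "expectation (\<lambda>\<omega>. (\<Sum>i\<in>I. X i \<omega>)\<^sup>2) = (\<Sum>i\<in>I. expectation (\<lambda>\<omega>. (X i \<omega>)\<^sup>2))"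
proof -
  have eq: "(\<lambda>\<omega>. (\<Sum>i\<in>I. X i \<omega>)\<^sup>2) = (\<lambda>\<omega>. \<Sum>i\<in>I. \<Sum>j\<in>I. X i \<omega> * X j \<omega>)"
    by (simp add: power2_eq_square sum_product)
  \<comment> \<open>The sum over the singleton \<open>{j}\<close> in \<open>indep_vars_sum\<close>
    turns independence of the family into independence of a pair.\<close>
  have indep2: "indep_var borel (X i) borel (X j)" if "i \<in> I" "j \<in> I" "i \<noteq> j" for i j
    using indep_vars_sum[of "{j}" i X] indep_vars_subset[OF indep, of "{i, j}"] that by simp
  have int2: "integrable M (\<lambda>\<omega>. X i \<omega> * X j \<omega>)" if "i \<in> I" "j \<in> I" for i j
    using that sq[of i] indep_var_integrable[OF indep2[of i j] int int]
    by (cases "i = j") (auto simp: power2_eq_square)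
  have expect2: "expectation (\<lambda>\<omega>. X i \<omega> * X j \<omega>) = (if j = i then expectation (\<lambda>\<omega>. (X i \<omega>)\<^sup>2) else 0)"
    if "i \<in> I" "j \<in> I" for i j
    using that indep_var_lebesgue_integral[OF indep2[of i j] int int] centered
    by (cases "i = j") (auto simp: power2_eq_square)
  show "integrable M (\<lambda>\<omega>. (\<Sum>i\<in>I. X i \<omega>)\<^sup>2)"
    unfolding eq by (intro Bochner_Integration.integrable_sum int2)
  show "expectation (\<lambda>\<omega>. (\<Sum>i\<in>I. X i \<omega>)\<^sup>2) = (\<Sum>i\<in>I. expectation (\<lambda>\<omega>. (X i \<omega>)\<^sup>2))"
    unfolding eq using \<open>finite I\<close>
    by (simp add: Bochner_Integration.integral_sum Bochner_Integration.integrable_sum int2 expect2)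
qed

text \<open>The squared norm is the sum of the squared coordinates, so the scalar case applies
  coordinate by coordinate; the coordinates of one vector may well be dependent.\<close>

lemma expectation_norm_sum_square_centered:
  fixes Y :: "'i \<Rightarrow> 'a \<Rightarrow> 'b::euclidean_space"
  assumes "finite I" and indep: "indep_vars (\<lambda>_. borel) Y I"
    and int: "\<And>i. i \<in> I \<Longrightarrow> integrable M (Y i)"
    and sq: "\<And>i. i \<in> I \<Longrightarrow> integrable M (\<lambda>\<omega>. (norm (Y i \<omega>))\<^sup>2)"
    and centered: "\<And>i. i \<in> I \<Longrightarrow> expectation (Y i) = 0"
  shows "integrable M (\<lambda>\<omega>. (norm (\<Sum>i\<in>I. Y i \<omega>))\<^sup>2)"
    and "expectation (\<lambda>\<omega>. (norm (\<Sum>i\<in>I. Y i \<omega>))\<^sup>2) = (\<Sum>i\<in>I. expectation (\<lambda>\<omega>. (norm (Y i \<omega>))\<^sup>2))"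
proof -
  have norm_sq: "(norm v)\<^sup>2 = (\<Sum>b\<in>Basis. (v \<bullet> b)\<^sup>2)" for v :: 'b
    by (simp add: norm_eq_sqrt_inner euclidean_inner[of v v] power2_eq_square sum_nonneg)
  have comp_indep: "indep_vars (\<lambda>_. borel) (\<lambda>i \<omega>. Y i \<omega> \<bullet> b) I" for b
    by (rule indep_vars_compose2[OF indep]) measurable
  have comp_sq: "integrable M (\<lambda>\<omega>. (Y i \<omega> \<bullet> b)\<^sup>2)" if "i \<in> I" "b \<in> Basis" for i b
  proof (rule Bochner_Integration.integrable_bound[OF sq[OF that(1)]])
    show "(\<lambda>\<omega>. (Y i \<omega> \<bullet> b)\<^sup>2) \<in> borel_measurable M"
      using int[OF that(1)] by measurable
    show "AE \<omega> in M. norm ((Y i \<omega> \<bullet> b)\<^sup>2) \<le> norm ((norm (Y i \<omega>))\<^sup>2)"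
      using Basis_le_norm[OF that(2)] by (auto simp: power2_le_iff_abs_le)
  qed
  have comp_int: "integrable M (\<lambda>\<omega>. Y i \<omega> \<bullet> b)" if "i \<in> I" for i b
    using int[OF that] by simp
  have comp_centered: "expectation (\<lambda>\<omega>. Y i \<omega> \<bullet> b) = 0" if "i \<in> I" for i b
    using int[OF that] centered[OF that] by simp
  note comp = expectation_sum_square_centered[OF \<open>finite I\<close> comp_indep comp_int comp_sq comp_centered]
  show "integrable M (\<lambda>\<omega>. (norm (\<Sum>i\<in>I. Y i \<omega>))\<^sup>2)"
    unfolding norm_sq inner_sum_left by (intro Bochner_Integration.integrable_sum comp)
  show "expectation (\<lambda>\<omega>. (norm (\<Sum>i\<in>I. Y i \<omega>))\<^sup>2) = (\<Sum>i\<in>I. expectation (\<lambda>\<omega>. (norm (Y i \<omega>))\<^sup>2))"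
    unfolding norm_sq inner_sum_left
    by (simp add: Bochner_Integration.integral_sum comp comp_sq) (rule sum.swap)
qed

text \<open>Independence gives the product rule for indicators of sets in \<open>\<G>\<close>;
  linearity and monotone convergence extend it to \<open>h\<close>. It serves to separate the output
  index from quantities determined by the run.\<close>

lemma nn_integral_indep_indicator:
  assumes indep: "indep_set \<A> \<G>" and \<G>: "sigma_algebra (space M) \<G>"
    and A: "A \<in> \<A>" and h: "h \<in> borel_measurable (sigma (space M) \<G>)"
  shows "(\<integral>\<^sup>+\<omega>. h \<omega> * indicator A \<omega> \<partial>M) = (\<integral>\<^sup>+\<omega>. h \<omega> \<partial>M) * emeasure M A"
proof -
  have sets: "sets (sigma (space M) \<G>) = \<G>"
    using \<G> by (rule sigma_algebra.sets_measure_of_eq)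
  have ev: "A \<in> events" "\<G> \<subseteq> events"
    using indep_setD_ev1[OF indep] indep_setD_ev2[OF indep] A by auto
  have sub: "f \<in> borel_measurable M" if "f \<in> borel_measurable (sigma (space M) \<G>)" for f :: "'a \<Rightarrow> ennreal"
    using that ev(2) by (intro measurable_from_subalg[of M "sigma (space M) \<G>"])
      (auto simp: subalgebra_def sets space_measure_of_conv)
  show ?thesis
    using h
  proof induction
    case (cong f g)
    then have eq: "f \<omega> = g \<omega>" if "\<omega> \<in> space M" for \<omega>
      using that by (simp add: space_measure_of_conv)
    show ?case
      using cong.IH by (simp add: eq cong: nn_integral_cong)
  next
    case (set B)
    then have B: "B \<in> \<G>" by (simp add: sets)
    have "(\<integral>\<^sup>+\<omega>. indicator B \<omega> * indicator A \<omega> \<partial>M) = emeasure M (A \<inter> B)"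
      using B ev by (subst nn_integral_indicator[symmetric])
        (auto intro!: nn_integral_cong simp: indicator_def)
    also have "\<dots> = ennreal (prob A * prob B)"
      using indep_setD[OF indep A B] by (simp add: emeasure_eq_measure)
    also have "\<dots> = emeasure M B * emeasure M A"
      by (simp add: emeasure_eq_measure ennreal_mult mult.commute)
    finally show ?case
      using B ev by (simp add: subset_eq)
  next
    case (mult u c)
    have [measurable]: "u \<in> borel_measurable M" "A \<in> events"
      using sub[OF mult.hyps(2)] ev(1) by auto
    have "(\<integral>\<^sup>+\<omega>. c * u \<omega> * indicator A \<omega> \<partial>M) = c * (\<integral>\<^sup>+\<omega>. u \<omega> * indicator A \<omega> \<partial>M)"
      unfolding mult.assoc by (rule nn_integral_cmult) measurable
    also have "\<dots> = (\<integral>\<^sup>+\<omega>. c * u \<omega> \<partial>M) * emeasure M A"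
      unfolding mult.IH by (subst nn_integral_cmult) (simp_all add: mult.assoc)
    finally show ?case .
  next
    case (add u v)
    have [measurable]: "u \<in> borel_measurable M" "v \<in> borel_measurable M" "A \<in> events"
      using sub[OF add.hyps(1)] sub[OF add.hyps(3)] ev(1) by auto
    have "(\<integral>\<^sup>+\<omega>. (v \<omega> + u \<omega>) * indicator A \<omega> \<partial>M)
        = (\<integral>\<^sup>+\<omega>. v \<omega> * indicator A \<omega> \<partial>M) + (\<integral>\<^sup>+\<omega>. u \<omega> * indicator A \<omega> \<partial>M)"
      unfolding distrib_right by (rule nn_integral_add) measurable
    also have "\<dots> = (\<integral>\<^sup>+\<omega>. v \<omega> + u \<omega> \<partial>M) * emeasure M A"
      unfolding add.IH by (subst nn_integral_add) (simp_all add: distrib_right)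
    finally show ?case .
  next
    case (seq U)
    have [measurable]: "\<And>i. U i \<in> borel_measurable M" "A \<in> events"
      using sub[OF seq.hyps(1)] ev(1) by auto
    have "(\<integral>\<^sup>+\<omega>. (SUP i. U i) \<omega> * indicator A \<omega> \<partial>M) = (\<integral>\<^sup>+\<omega>. (SUP i. U i \<omega> * indicator A \<omega>) \<partial>M)"
      by (simp add: SUP_mult_right_ennreal image_comp)
    also have "\<dots> = (SUP i. \<integral>\<^sup>+\<omega>. U i \<omega> * indicator A \<omega> \<partial>M)"
      using seq.hyps by (intro nn_integral_monotone_convergence_SUP)
        (auto simp: incseq_def le_fun_def intro!: mult_right_mono)
    also have "\<dots> = (SUP i. \<integral>\<^sup>+\<omega>. U i \<omega> \<partial>M) * emeasure M A"
      by (simp add: seq.IH SUP_mult_right_ennreal)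
    also have "(SUP i. \<integral>\<^sup>+\<omega>. U i \<omega> \<partial>M) = (\<integral>\<^sup>+\<omega>. (SUP i. U i) \<omega> \<partial>M)"
      using seq.hyps by (simp add: nn_integral_monotone_convergence_SUP image_comp)
    finally show ?case .
  qed
qed

end

section \<open>Upper expectations bounded by measurable majorants\<close>

lemma upper_expectation_le:
  "g \<in> borel_measurable M \<Longrightarrow> (\<And>\<omega>. \<omega> \<in> space M \<Longrightarrow> X \<omega> \<le> g \<omega>) \<Longrightarrow> (\<integral>\<^sup>+\<omega>. g \<omega> \<partial>M) \<le> u
    \<Longrightarrow> upper_expectation M X \<le> u"
  unfolding upper_expectation_def by (rule INF_lower2) auto

text \<open>A rearrangement of \<open>0 \<le> (y - \<epsilon>)\<^sup>2\<close> for finite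
  \<open>y\<close>; for infinite \<open>y\<close> the right-hand side is infinite too.\<close>

lemma ennreal_le_half_plus_square:
  assumes "\<epsilon> > 0"
  shows "y \<le> ennreal (\<epsilon> / 2) + ennreal (1 / (2 * \<epsilon>)) * y\<^sup>2"
proof (cases y)
  case (real a)
  have "0 \<le> (a - \<epsilon>)\<^sup>2 / (2 * \<epsilon>)" using assms by simp
  also have "\<dots> = \<epsilon> / 2 + 1 / (2 * \<epsilon>) * a\<^sup>2 - a"
    using assms by (simp add: field_simps power2_eq_square)
  finally have "a \<le> \<epsilon> / 2 + 1 / (2 * \<epsilon>) * a\<^sup>2" by simp
  then show ?thesis
    using real assms
    by (simp add: ennreal_power ennreal_mult[symmetric] ennreal_plus[symmetric] del: ennreal_plus)
qed (use assms in \<open>simp add: ennreal_mult_top power2_eq_square\<close>)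

text \<open>\<open>X\<close> is not assumed measurable, so the passage from second to first moment
  is made on majorants: \<open>g\<close> yields the affine majorant \<open>?h\<close> of
  \<open>X\<close>, with integral at most \<open>\<epsilon> / 2 + \<epsilon> / 2\<close>.\<close>

lemma (in prob_space) upper_expectation_le_of_square:
  assumes [measurable]: "g \<in> borel_measurable M" and "\<And>\<omega>. \<omega> \<in> space M \<Longrightarrow> (X \<omega>)\<^sup>2 \<le> g \<omega>"
    and g: "(\<integral>\<^sup>+\<omega>. g \<omega> \<partial>M) \<le> ennreal (\<epsilon>\<^sup>2)" and \<epsilon>: "\<epsilon> > 0"
  shows "upper_expectation M X \<le> ennreal \<epsilon>"
proof (rule upper_expectation_le)
  let ?h = "\<lambda>\<omega>. ennreal (\<epsilon> / 2) + ennreal (1 / (2 * \<epsilon>)) * g \<omega>"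
  show "?h \<in> borel_measurable M" by measurable
  show "X \<omega> \<le> ?h \<omega>" if "\<omega> \<in> space M" for \<omega>
    using ennreal_le_half_plus_square[OF \<epsilon>, of "X \<omega>"] assms(2)[OF that]
    by (meson add_left_mono mult_left_mono order_trans zero_le)
  have "(\<integral>\<^sup>+\<omega>. ?h \<omega> \<partial>M) = ennreal (\<epsilon> / 2) + ennreal (1 / (2 * \<epsilon>)) * (\<integral>\<^sup>+\<omega>. g \<omega> \<partial>M)"
    by (simp add: nn_integral_add nn_integral_cmult emeasure_space_1)
  also have "\<dots> \<le> ennreal (\<epsilon> / 2) + ennreal (1 / (2 * \<epsilon>)) * ennreal (\<epsilon>\<^sup>2)"
    by (intro add_left_mono mult_left_mono g) simp
  also have "\<dots> = ennreal (\<epsilon> / 2 + 1 / (2 * \<epsilon>) * \<epsilon>\<^sup>2)"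
    using \<epsilon> by (subst ennreal_plus) (auto simp: ennreal_mult[symmetric])
  also have "\<epsilon> / 2 + 1 / (2 * \<epsilon>) * \<epsilon>\<^sup>2 = \<epsilon>"
    using \<epsilon> by (simp add: power2_eq_square)
  finally show "(\<integral>\<^sup>+\<omega>. ?h \<omega> \<partial>M) \<le> ennreal \<epsilon>" .
qed

section \<open>The mini-batch stochastic proximal gradient method\<close>

text \<open>The library's \<open>indep_var\<close> requires both variables to take values in the same type.\<close>

lemma (in prob_space) distr_indep_pair:
  assumes indep: "indep_set \<A> \<B>"
    and X: "random_variable S X" "\<And>A. A \<in> sets S \<Longrightarrow> X -` A \<inter> space M \<in> \<A>"
    and Y: "random_variable N Y" "\<And>B. B \<in> sets N \<Longrightarrow> Y -` B \<inter> space M \<in> \<B>"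
  shows "distr M (S \<Otimes>\<^sub>M N) (\<lambda>\<omega>. (X \<omega>, Y \<omega>)) = distr M S X \<Otimes>\<^sub>M distr M N Y"
proof (rule pair_measure_eqI[symmetric])
  show "sigma_finite_measure (distr M S X)" "sigma_finite_measure (distr M N Y)"
    using X(1) Y(1)
    by (auto intro!: prob_space_imp_sigma_finite prob_space_distr)
  show "sets (distr M S X \<Otimes>\<^sub>M distr M N Y) = sets (distr M (S \<Otimes>\<^sub>M N) (\<lambda>\<omega>. (X \<omega>, Y \<omega>)))"
    by (simp cong: sets_pair_measure_cong)
  fix A B assume "A \<in> sets (distr M S X)" "B \<in> sets (distr M N Y)"
  then have A: "A \<in> sets S" and B: "B \<in> sets N" by simp_all
  have "(\<lambda>\<omega>. (X \<omega>, Y \<omega>)) -` (A \<times> B) \<inter> space M = (X -` A \<inter> space M) \<inter> (Y -` B \<inter> space M)"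
    by auto
  then show "emeasure (distr M S X) A * emeasure (distr M N Y) B
      = emeasure (distr M (S \<Otimes>\<^sub>M N) (\<lambda>\<omega>. (X \<omega>, Y \<omega>))) (A \<times> B)"
    using A B X Y indep_setD[OF indep X(2)[OF A] Y(2)[OF B]]
    by (simp add: emeasure_distr emeasure_eq_measure ennreal_mult)
qed

section \<open>The history of the run and its fresh batches\<close>

context mb_spg
begin

definition stoch_grad :: "nat \<Rightarrow> 'w \<Rightarrow> 'a" where
  "stoch_grad t \<omega> = (1 / real (m t)) *\<^sub>R (\<Sum>i<m t. grad (x t \<omega>) (\<xi> t i \<omega>))"

text \<open>The history as a measurable space, so that being determined by the past can be stated as
  measurability.\<close>

definition past :: "nat \<Rightarrow> 'w measure" where
  "past t = sigma (space M) (past_events M D m \<xi> x t)"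

lemma sigma_algebra_past_events: "sigma_algebra (space M) (past_events M D m \<xi> x t)"
  unfolding past_events_def by (rule sigma_algebra_sigma_sets) auto

lemma space_past [simp]: "space (past t) = space M"
  by (simp add: past_def space_measure_of_conv)

lemma sets_past [simp]: "sets (past t) = past_events M D m \<xi> x t"
  unfolding past_def by (rule sigma_algebra.sets_measure_of_eq[OF sigma_algebra_past_events])

lemma iterate_in_past_events:
  "s \<le> t \<Longrightarrow> A \<in> sets borel \<Longrightarrow> x s -` A \<inter> space M \<in> past_events M D m \<xi> x t"
  unfolding past_events_def by (rule sigma_sets.Basic) blast

lemma iterate_past_measurable: "s \<le> t \<Longrightarrow> x s \<in> borel_measurable (past t)"
  by (rule measurableI) (simp_all add: iterate_in_past_events)

lemma sample_past_measurable:
  assumes "s < t" "t \<le> T" "i < m s"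
  shows "\<xi> s i \<in> measurable (past t) D"
proof (rule measurableI)
  show "\<xi> s i \<omega> \<in> space D" if "\<omega> \<in> space (past t)" for \<omega>
    using that assms sample_distr[of s i] by (auto dest: measurable_space)
qed (use assms in \<open>auto simp: past_events_def\<close>)

text \<open>The batch of iteration \<open>s\<close> enters the history only from time
  \<open>s + 1\<close> on, hence the strict bound on \<open>s\<close>.\<close>

lemma stoch_grad_past_measurable:
  assumes "(\<lambda>(y, s). grad y s) \<in> borel_measurable (borel \<Otimes>\<^sub>M D)" "s < t" "t \<le> T"
  shows "stoch_grad s \<in> borel_measurable (past t)"
proof -
  have [measurable]: "x s \<in> borel_measurable (past t)"
    using assms by (intro iterate_past_measurable) auto
  have [measurable]: "(\<lambda>\<omega>. grad (x s \<omega>) (\<xi> s i \<omega>)) \<in> borel_measurable (past t)" if "i < m s" for i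
  proof -
    have [measurable]: "\<xi> s i \<in> measurable (past t) D"
      using assms that by (intro sample_past_measurable) auto
    show ?thesis
      using measurable_compose[OF _ assms(1), of "\<lambda>\<omega>. (x s \<omega>, \<xi> s i \<omega>)" "past t"] by simp
  qed
  show ?thesis
    unfolding stoch_grad_def by (intro borel_measurable_scaleR borel_measurable_sum) auto
qed

text \<open>That the history consists of events of \<open>M\<close> is contained in the independence
  of the output from it.\<close>

lemma subalgebra_past: "subalgebra M (past T)"
  using indep_setD_ev2[OF output_indep] by (auto simp: subalgebra_def)

text \<open>Restriction to the indices below \<open>m t\<close> makes the batch a single random
  element of the product space \<open>PiM {..<m t}\<close>.\<close>

definition batch :: "nat \<Rightarrow> 'w \<Rightarrow> nat \<Rightarrow> 's" where
  "batch t \<omega> = (\<lambda>i\<in>{..<m t}. \<xi> t i \<omega>)"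

lemma batch_measurable:
  assumes "t < T"
  shows "random_variable (PiM {..<m t} (\<lambda>_. D)) (batch t)"
  unfolding batch_def using assms sample_distr by (intro measurable_restrict) auto

text \<open>The iterate \<open>x t\<close> belongs to the history and the batch is fresh, so their
  joint law is a product.\<close>

lemma distr_iterate_batch:
  assumes "t < T"
  shows "distr M (borel \<Otimes>\<^sub>M PiM {..<m t} (\<lambda>_. D)) (\<lambda>\<omega>. (x t \<omega>, batch t \<omega>))
    = distr M borel (x t) \<Otimes>\<^sub>M distr M (PiM {..<m t} (\<lambda>_. D)) (batch t)"
proof (rule distr_indep_pair[OF fresh[OF assms]])
  show "random_variable borel (x t)"
    using assms by (intro iterate_measurable) auto
  show "x t -` A \<inter> space M \<in> past_events M D m \<xi> x t" if "A \<in> sets borel" for A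
    using that by (simp add: iterate_in_past_events)
  \<comment> \<open>Freshness speaks of the sigma-algebra generated by the single samples. The whole
    batch is measurable for it because each of its components is.\<close>
  let ?N = "sigma (space M) (batch_events M D m \<xi> t)"
  have sets_N: "sets ?N = batch_events M D m \<xi> t"
    unfolding batch_events_def
    by (rule sigma_algebra.sets_measure_of_eq) (auto intro: sigma_algebra_sigma_sets)
  have sample: "\<xi> t i -` A \<inter> space M \<in> batch_events M D m \<xi> t" if "i < m t" "A \<in> sets D" for i A
    unfolding batch_events_def using that by (intro sigma_sets.Basic) blast
  have xi: "\<xi> t i \<in> measurable ?N D" if "i < m t" for i
  proof (rule measurableI)
    show "\<xi> t i \<omega> \<in> space D" if "\<omega> \<in> space ?N" for \<omega>
      using that assms \<open>i < m t\<close> sample_distr[of t i]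
      by (auto dest: measurable_space simp: space_measure_of_conv)
  qed (use that sample in \<open>simp add: sets_N space_measure_of_conv\<close>)
  have "batch t \<in> measurable ?N (PiM {..<m t} (\<lambda>_. D))"
    unfolding batch_def using xi by (intro measurable_restrict) auto
  then show "batch t -` A \<inter> space M \<in> batch_events M D m \<xi> t"
    if "A \<in> sets (PiM {..<m t} (\<lambda>_. D))" for A
    using measurable_sets[of "batch t" ?N, OF _ that] by (simp add: sets_N space_measure_of_conv)
qed (rule batch_measurable[OF assms])

text \<open>At a point \<open>y\<close> fixed in advance the error is a mean of independent centered
  vectors. The squared norm of their sum has expectation at most \<open>m t * v\<close>, and
  averaging divides by the square of \<open>m t\<close>.\<close>

lemma batch_mean_variance:
  assumes "t < T" "m t > 0"
    and unbiased: "integrable D (grad y)" "(\<integral>s. grad y s \<partial>D) = gf"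
    and variance: "integrable D (\<lambda>s. (norm (grad y s - gf))\<^sup>2)"
      "(\<integral>s. (norm (grad y s - gf))\<^sup>2 \<partial>D) \<le> v"
  shows "(\<integral>\<^sup>+\<omega>. ennreal ((norm ((1 / real (m t)) *\<^sub>R (\<Sum>i<m t. grad y (\<xi> t i \<omega>)) - gf))\<^sup>2) \<partial>M)
    \<le> ennreal (v / real (m t))"
proof -
  define Y where "Y i \<omega> = grad y (\<xi> t i \<omega>) - gf" for i \<omega>
  have rv: "random_variable D (\<xi> t i)" and distr: "distr M D (\<xi> t i) = D" if "i < m t" for i
    using sample_distr[OF assms(1) that] by auto
  have [measurable]: "grad y \<in> borel_measurable D"
    using unbiased(1) by (rule borel_measurable_integrable)
  \<comment> \<open>A nonempty batch contains sample 0, and its law \<open>D\<close> is therefore a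
    probability measure.\<close>
  have D: "prob_space D"
    using prob_space_distr[OF rv[OF assms(2)]] distr[OF assms(2)] by simp
  have int_transfer: "integrable M (\<lambda>\<omega>. h (\<xi> t i \<omega>))" "expectation (\<lambda>\<omega>. h (\<xi> t i \<omega>)) = (\<integral>s. h s \<partial>D)"
    if "i < m t" "integrable D h" for i and h :: "'s \<Rightarrow> 'b::{banach, second_countable_topology}"
    using that(2) integrable_distr[OF rv[OF that(1)], of h] integral_distr[OF rv[OF that(1)], of h]
      distr[OF that(1)] by auto
  have int_diff: "integrable D (\<lambda>s. grad y s - gf)"
    using unbiased(1) D by (intro Bochner_Integration.integrable_diff)
      (auto simp: prob_space.finite_measure finite_measure.integrable_const)
  have zero: "(\<integral>s. grad y s - gf \<partial>D) = 0"
    using unbiased D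
    by (subst Bochner_Integration.integral_diff)
      (auto simp: prob_space.finite_measure finite_measure.integrable_const prob_space.prob_space)
  have indep: "indep_vars (\<lambda>_. borel) Y {..<m t}"
    unfolding Y_def
    by (rule indep_vars_compose2[OF sample_indep[OF assms(1)], where Y = "\<lambda>_ s. grad y s - gf"])
      measurable
  note sum = expectation_norm_sum_square_centered[OF finite_lessThan indep]
  have Y: "integrable M (Y i)" "integrable M (\<lambda>\<omega>. (norm (Y i \<omega>))\<^sup>2)" "expectation (Y i) = 0"
    "expectation (\<lambda>\<omega>. (norm (Y i \<omega>))\<^sup>2) \<le> v" if "i < m t" for i
    unfolding Y_def using that int_transfer[OF that int_diff] int_transfer[OF that variance(1)]
      variance(2) zero by simp_all
  have "(1 / real (m t)) *\<^sub>R (\<Sum>i<m t. grad y (\<xi> t i \<omega>)) - gf = (1 / real (m t)) *\<^sub>R (\<Sum>i<m t. Y i \<omega>)" for \<omega>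
    using assms(2) by (simp add: Y_def sum_subtractf scaleR_diff_right sum_constant_scaleR)
  then have "(\<integral>\<^sup>+\<omega>. ennreal ((norm ((1 / real (m t)) *\<^sub>R (\<Sum>i<m t. grad y (\<xi> t i \<omega>)) - gf))\<^sup>2) \<partial>M)
    = (\<integral>\<^sup>+\<omega>. ennreal ((1 / real (m t))\<^sup>2 * (norm (\<Sum>i<m t. Y i \<omega>))\<^sup>2) \<partial>M)"
    by (simp add: power_divide)
  also have "\<dots> = ennreal (expectation (\<lambda>\<omega>. (1 / real (m t))\<^sup>2 * (norm (\<Sum>i<m t. Y i \<omega>))\<^sup>2))"
    using Y by (intro nn_integral_eq_integral integrable_mult_right sum) auto
  also have "\<dots> = ennreal ((1 / real (m t))\<^sup>2 * (\<Sum>i<m t. expectation (\<lambda>\<omega>. (norm (Y i \<omega>))\<^sup>2)))"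
    using Y sum by simp
  also have "\<dots> \<le> ennreal ((1 / real (m t))\<^sup>2 * (real (m t) * v))"
    using Y(4) sum_bounded_above[of "{..<m t}" "\<lambda>i. expectation (\<lambda>\<omega>. (norm (Y i \<omega>))\<^sup>2)" v]
    by (intro ennreal_leI mult_left_mono) auto
  also have "(1 / real (m t))\<^sup>2 * (real (m t) * v) = v / real (m t)"
    using assms(2) by (simp add: power2_eq_square)
  finally show ?thesis .
qed

text \<open>The point \<open>x t\<close> is itself random. Tonelli's theorem on the product law of
  iterate and batch freezes it at some \<open>y\<close>, where \<open>batch_mean_variance\<close>
  gives a bound uniform in \<open>y\<close>.\<close>

lemma stoch_grad_variance:
  assumes "t < T" "m t > 0"
    and joint: "(\<lambda>(y, s). grad y s) \<in> borel_measurable (borel \<Otimes>\<^sub>M D)"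
    and [measurable]: "gf \<in> borel_measurable borel"
    and unbiased: "\<And>y. integrable D (grad y)" "\<And>y. (\<integral>s. grad y s \<partial>D) = gf y"
    and variance: "\<And>y. integrable D (\<lambda>s. (norm (grad y s - gf y))\<^sup>2)"
      "\<And>y. (\<integral>s. (norm (grad y s - gf y))\<^sup>2 \<partial>D) \<le> v"
  shows "(\<integral>\<^sup>+\<omega>. ennreal ((norm (stoch_grad t \<omega> - gf (x t \<omega>)))\<^sup>2) \<partial>M) \<le> ennreal (v / real (m t))"
proof -
  let ?P = "PiM {..<m t} (\<lambda>_. D)"
  define h where
    "h = (\<lambda>(y, S). ennreal ((norm ((1 / real (m t)) *\<^sub>R (\<Sum>i<m t. grad y (S i)) - gf y))\<^sup>2))"
  have "(\<lambda>p. grad (fst p) (snd p i)) \<in> borel_measurable (borel \<Otimes>\<^sub>M ?P)" if "i < m t" for i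
  proof -
    have "(\<lambda>p. (fst p, snd p i)) \<in> measurable (borel \<Otimes>\<^sub>M ?P) (borel \<Otimes>\<^sub>M D)"
      using that
      by (intro measurable_Pair measurable_fst measurable_compose[OF measurable_snd]
          measurable_component_singleton) auto
    from measurable_compose[OF this joint] show ?thesis by simp
  qed
  then have [measurable]: "(\<lambda>p. \<Sum>i<m t. grad (fst p) (snd p i)) \<in> borel_measurable (borel \<Otimes>\<^sub>M ?P)"
    by (intro borel_measurable_sum) auto
  have h [measurable]: "h \<in> borel_measurable (borel \<Otimes>\<^sub>M ?P)"
    unfolding h_def case_prod_beta by measurable
  have xr [measurable]: "x t \<in> borel_measurable M" and br [measurable]: "batch t \<in> measurable M ?P"
    using assms(1) by (auto intro: iterate_measurable batch_measurable)
  interpret B: prob_space "distr M ?P (batch t)"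
    by (rule prob_space_distr) (rule br)
  interpret X: prob_space "distr M borel (x t)"
    by (rule prob_space_distr) (rule xr)
  have "(\<integral>\<^sup>+\<omega>. ennreal ((norm (stoch_grad t \<omega> - gf (x t \<omega>)))\<^sup>2) \<partial>M)
      = (\<integral>\<^sup>+\<omega>. h (x t \<omega>, batch t \<omega>) \<partial>M)"
    by (simp add: h_def stoch_grad_def batch_def)
  also have "\<dots> = (\<integral>\<^sup>+p. h p \<partial>(distr M borel (x t) \<Otimes>\<^sub>M distr M ?P (batch t)))"
    unfolding distr_iterate_batch[OF assms(1), symmetric] by (subst nn_integral_distr) auto
  also have "\<dots> = (\<integral>\<^sup>+y. \<integral>\<^sup>+S. h (y, S) \<partial>distr M ?P (batch t) \<partial>distr M borel (x t))"
    by (rule B.nn_integral_fst[symmetric]) measurable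
  also have "\<dots> \<le> (\<integral>\<^sup>+y. ennreal (v / real (m t)) \<partial>distr M borel (x t))"
  proof (rule nn_integral_mono)
    fix y
    have "(\<integral>\<^sup>+S. h (y, S) \<partial>distr M ?P (batch t)) = (\<integral>\<^sup>+\<omega>. h (y, batch t \<omega>) \<partial>M)"
      by (rule nn_integral_distr) measurable
    also have "\<dots> \<le> ennreal (v / real (m t))"
      using batch_mean_variance[OF assms(1,2) unbiased variance, of y] by (simp add: h_def batch_def)
    finally show "(\<integral>\<^sup>+S. h (y, S) \<partial>distr M ?P (batch t)) \<le> ennreal (v / real (m t))" .
  qed
  also have "\<dots> = ennreal (v / real (m t))"
    using X.emeasure_space_1 by simp
  finally show ?thesis .
qed

section \<open>The uniformly chosen output index\<close>

lemma prob_output: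
  assumes "t < T"
  shows "emeasure M (R -` {Suc t} \<inter> space M) = ennreal (1 / real T)"
proof -
  have "emeasure M (R -` {Suc t} \<inter> space M) = emeasure (distr M (count_space UNIV) R) {Suc t}"
    by (rule emeasure_distr[OF output_measurable, symmetric]) simp
  also have "\<dots> = ennreal (1 / real T)"
    using assms by (simp add: output_uniform emeasure_pmf_single)
  finally show ?thesis .
qed

lemma AE_output: "T > 0 \<Longrightarrow> AE \<omega> in M. R \<omega> \<in> {1..T}"
proof -
  assume "T > 0"
  then have "AE k in distr M (count_space UNIV) R. k \<in> {1..T}"
    unfolding output_uniform by (intro AE_pmfI) (auto simp: set_pmf_of_set)
  then show ?thesis
    by (subst (asm) AE_distr_iff[OF output_measurable]) auto
qed

text \<open>Almost surely the integrand is the sum over \<open>t\<close> of \<open>B t\<close> times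
  the indicator of \<open>R = Suc t\<close>. Since \<open>B t\<close> is determined by the history
  and \<open>R\<close> is independent of it, each term splits off the factor \<open>1 / T\<close>.
  The default value \<open>\<infinity>\<close> is taken only on a null set.\<close>

lemma nn_integral_random_output:
  fixes B :: "nat \<Rightarrow> 'w \<Rightarrow> ennreal"
  assumes "T > 0" and B: "\<And>t. t < T \<Longrightarrow> B t \<in> borel_measurable (past T)"
  shows "(\<integral>\<^sup>+\<omega>. (if R \<omega> \<in> {1..T} then B (R \<omega> - 1) \<omega> else \<infinity>) \<partial>M)
    = ennreal (1 / real T) * (\<Sum>t<T. \<integral>\<^sup>+\<omega>. B t \<omega> \<partial>M)"
proof -
  have BM: "B t \<in> borel_measurable M" if "t < T" for t
    using measurable_from_subalg[OF subalgebra_past B[OF that]] .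
  have [measurable]: "R -` {Suc t} \<inter> space M \<in> events" for t
    by (rule measurable_sets[OF output_measurable]) simp
  have "(\<integral>\<^sup>+\<omega>. (if R \<omega> \<in> {1..T} then B (R \<omega> - 1) \<omega> else \<infinity>) \<partial>M)
      = (\<integral>\<^sup>+\<omega>. (\<Sum>t<T. B t \<omega> * indicator (R -` {Suc t} \<inter> space M) \<omega>) \<partial>M)"
  proof (rule nn_integral_cong_AE)
    show "AE \<omega> in M. (if R \<omega> \<in> {1..T} then B (R \<omega> - 1) \<omega> else \<infinity>)
        = (\<Sum>t<T. B t \<omega> * indicator (R -` {Suc t} \<inter> space M) \<omega>)"
      using AE_output[OF assms(1)] AE_space
    proof eventually_elim
      case (elim \<omega>)
      then obtain k where k: "R \<omega> = Suc k" "k < T" by (cases "R \<omega>") auto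
      have "(\<Sum>t<T. B t \<omega> * indicator (R -` {Suc t} \<inter> space M) \<omega>) = (\<Sum>t<T. if t = k then B t \<omega> else 0)"
        using elim k by (intro sum.cong) (auto simp: indicator_def)
      with elim k show ?case by simp
    qed
  qed
  also have "\<dots> = (\<Sum>t<T. \<integral>\<^sup>+\<omega>. B t \<omega> * indicator (R -` {Suc t} \<inter> space M) \<omega> \<partial>M)"
    using BM by (intro nn_integral_sum) auto
  also have "\<dots> = (\<Sum>t<T. (\<integral>\<^sup>+\<omega>. B t \<omega> \<partial>M) * ennreal (1 / real T))"
  proof (rule sum.cong)
    fix t assume "t \<in> {..<T}"
    then show "(\<integral>\<^sup>+\<omega>. B t \<omega> * indicator (R -` {Suc t} \<inter> space M) \<omega> \<partial>M)
        = (\<integral>\<^sup>+\<omega>. B t \<omega> \<partial>M) * ennreal (1 / real T)"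
      using B[of t] prob_output[of t]
      by (subst nn_integral_indep_indicator[OF output_indep sigma_algebra_past_events])
        (auto simp: past_def)
  qed simp
  also have "\<dots> = ennreal (1 / real T) * (\<Sum>t<T. \<integral>\<^sup>+\<omega>. B t \<omega> \<partial>M)"
    by (simp add: sum_distrib_left mult.commute)
  finally show ?thesis .
qed

lemma random_output_measurable:
  fixes B :: "nat \<Rightarrow> 'w \<Rightarrow> ennreal"
  assumes B: "\<And>t. t < T \<Longrightarrow> B t \<in> borel_measurable (past T)"
  shows "(\<lambda>\<omega>. if R \<omega> \<in> {1..T} then B (R \<omega> - 1) \<omega> else \<infinity>) \<in> borel_measurable M"
proof (rule measurable_compose_countable[OF _ output_measurable])
  fix k
  show "(\<lambda>\<omega>. if k \<in> {1..T} then B (k - 1) \<omega> else \<infinity>) \<in> borel_measurable M"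
  proof (cases "k \<in> {1..T}")
    case True
    then have "k - 1 < T" by auto
    from measurable_from_subalg[OF subalgebra_past B[OF this]] True show ?thesis by simp
  next
    case False
    then show ?thesis by (simp only: if_False borel_measurable_const)
  qed
qed

end

text \<open>\<open>V t\<close> is a subgradient at \<open>x (Suc t)\<close>, so the output
  \<open>x (R \<omega>)\<close> is paired with index \<open>R \<omega> - 1\<close>. The selected
  squared norm is a measurable majorant of the squared distance whose integral is an average over
  \<open>t\<close>; it serves both bounds.\<close>

lemma (in mb_spg) upper_expectation_dist_output:
  fixes F :: "'a \<Rightarrow> ereal" and V :: "nat \<Rightarrow> 'w \<Rightarrow> 'a"
  assumes "T > 0" "\<epsilon> > 0" and V: "\<And>t. t < T \<Longrightarrow> V t \<in> borel_measurable (past T)"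
    and subgrad: "\<And>t \<omega>. t < T \<Longrightarrow> \<omega> \<in> space M \<Longrightarrow> V t \<omega> \<in> frechet_subdiff F (x (Suc t) \<omega>)"
    and mean: "(\<Sum>t<T. \<integral>\<^sup>+\<omega>. ennreal ((norm (V t \<omega>))\<^sup>2) \<partial>M) \<le> ennreal (real T * \<epsilon>\<^sup>2)"
  shows "upper_expectation M (\<lambda>\<omega>. (dist_zero (frechet_subdiff F (x (R \<omega>) \<omega>)))\<^sup>2) \<le> ennreal (\<epsilon>\<^sup>2)"
    and "upper_expectation M (\<lambda>\<omega>. dist_zero (frechet_subdiff F (x (R \<omega>) \<omega>))) \<le> ennreal \<epsilon>"
proof -
  define B where "B t \<omega> = ennreal ((norm (V t \<omega>))\<^sup>2)" for t \<omega>
  \<comment> \<open>\<open>R\<close> may leave \<open>{1..T}\<close> on a null set, where nothing is known about the iterates.\<close>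
  define g where "g \<omega> = (if R \<omega> \<in> {1..T} then B (R \<omega> - 1) \<omega> else \<infinity>)" for \<omega>
  have B: "B t \<in> borel_measurable (past T)" if "t < T" for t
    unfolding B_def using V[OF that] by measurable
  have g: "g \<in> borel_measurable M"
    unfolding g_def by (rule random_output_measurable[OF B])
  have "(\<integral>\<^sup>+\<omega>. g \<omega> \<partial>M) = ennreal (1 / real T) * (\<Sum>t<T. \<integral>\<^sup>+\<omega>. B t \<omega> \<partial>M)"
    unfolding g_def by (rule nn_integral_random_output[OF assms(1) B])
  also have "\<dots> \<le> ennreal (1 / real T) * ennreal (real T * \<epsilon>\<^sup>2)"
    using mean unfolding B_def by (intro mult_left_mono) auto
  also have "\<dots> = ennreal (\<epsilon>\<^sup>2)"
    using assms(1) by (simp add: ennreal_mult[symmetric])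
  finally have int_g: "(\<integral>\<^sup>+\<omega>. g \<omega> \<partial>M) \<le> ennreal (\<epsilon>\<^sup>2)" .
  have dist_g: "(dist_zero (frechet_subdiff F (x (R \<omega>) \<omega>)))\<^sup>2 \<le> g \<omega>" if "\<omega> \<in> space M" for \<omega>
  proof (cases "R \<omega> \<in> {1..T}")
    case True
    then obtain t where t: "R \<omega> = Suc t" "t < T" by (cases "R \<omega>") auto
    have "(dist_zero (frechet_subdiff F (x (R \<omega>) \<omega>)))\<^sup>2 \<le> (ennreal (norm (V t \<omega>)))\<^sup>2"
      using subgrad[OF t(2) that] by (intro power_mono dist_zero_le) (simp_all add: t)
    then show ?thesis using True t by (simp add: g_def B_def ennreal_power)
  next
    case False
    then have "g \<omega> = \<top>" unfolding g_def by (simp only: if_False infinity_ennreal_def)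
    then show ?thesis by simp
  qed
  show "upper_expectation M (\<lambda>\<omega>. (dist_zero (frechet_subdiff F (x (R \<omega>) \<omega>)))\<^sup>2) \<le> ennreal (\<epsilon>\<^sup>2)"
    by (rule upper_expectation_le[OF g dist_g int_g])
  show "upper_expectation M (\<lambda>\<omega>. dist_zero (frechet_subdiff F (x (R \<omega>) \<omega>))) \<le> ennreal \<epsilon>"
    by (rule upper_expectation_le_of_square[OF g dist_g int_g assms(2)])
qed

text \<open>Rounding up adds at most 1, which is below \<open>1 / e\<^sup>2\<close> once
  \<open>e < 1\<close>; hence the constant \<open>K + 1\<close>.\<close>

lemma nat_ceiling_inverse_square_bigo:
  fixes K :: real
  assumes "K \<ge> 0"
  shows "(\<lambda>e. real (nat \<lceil>K / e\<^sup>2\<rceil>)) \<in> O[at_right 0](\<lambda>e. 1 / e\<^sup>2)"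
proof (rule bigoI[of _ "K + 1"])
  show "\<forall>\<^sub>F e in at_right 0. norm (real (nat \<lceil>K / e\<^sup>2\<rceil>)) \<le> (K + 1) * norm (1 / e\<^sup>2)"
    using eventually_at_right_real[of 0 1]
  proof (rule eventually_mono)
    fix e :: real assume e: "e \<in> {0<..<1}"
    then have "e\<^sup>2 \<le> 1" by (simp add: power_le_one)
    have "real (nat \<lceil>K / e\<^sup>2\<rceil>) \<le> K / e\<^sup>2 + 1"
      using assms by (simp add: of_nat_nat)
    also have "\<dots> \<le> K / e\<^sup>2 + 1 / e\<^sup>2"
      using e \<open>e\<^sup>2 \<le> 1\<close> by simp
    finally show "norm (real (nat \<lceil>K / e\<^sup>2\<rceil>)) \<le> (K + 1) * norm (1 / e\<^sup>2)"
      by (simp add: add_divide_distrib)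
  qed simp
qed

theorem corollary1:
  fixes f :: "real ^ 'd \<Rightarrow> real"
    and fs :: "real ^ 'd \<Rightarrow> 's \<Rightarrow> real"
    and grad_f :: "real ^ 'd \<Rightarrow> real ^ 'd"
    and grad_fs :: "real ^ 'd \<Rightarrow> 's \<Rightarrow> real ^ 'd"
    and r F :: "real ^ 'd \<Rightarrow> ereal"
    and D :: "'s measure"
    and M :: "'w measure"
    and x0 xstar :: "real ^ 'd"
    and \<xi> :: "nat \<Rightarrow> nat \<Rightarrow> 'w \<Rightarrow> 's"
    and x :: "nat \<Rightarrow> 'w \<Rightarrow> real ^ 'd"
    and R :: "'w \<Rightarrow> nat"
    and \<sigma> \<Delta> L c \<eta> c1 c2 \<epsilon> :: real
    and T m :: "real \<Rightarrow> nat"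
  assumes "prob_space D"
    and f_integrable: "\<And>x. integrable D (fs x)"
    and f_expectation: "\<And>x. f x = (\<integral>s. fs x s \<partial>D)"
    and fs_gradient: "\<And>x s. s \<in> space D \<Longrightarrow> GDERIV (\<lambda>y. fs y s) x :> grad_fs x s"
    and r_proper: "proper r"
    and r_lsc: "lower_semicontinuous r"
    and F_def: "\<And>x. F x = ereal (f x) + r x"
    and unbiased: "\<And>x. integrable D (grad_fs x) \<and> (\<integral>s. grad_fs x s \<partial>D) = grad_f x"
    and sigma_pos: "\<sigma> > 0"
    and variance: "\<And>x. integrable D (\<lambda>s. (norm (grad_fs x s - grad_f x))\<^sup>2) \<and>
          (\<integral>s. (norm (grad_fs x s - grad_f x))\<^sup>2 \<partial>D) \<le> \<sigma>\<^sup>2"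
    and minimizer: "\<And>x. F xstar \<le> F x"
    and Delta_pos: "\<Delta> > 0"
    and initial_gap: "F x0 - F xstar \<le> ereal \<Delta>"
    and f_gradient: "\<And>x. GDERIV f x :> grad_f x"
    and L_pos: "L > 0"
    and smooth: "\<And>x y. norm (grad_f x - grad_f y) \<le> L * norm (x - y)"
    and c_range: "0 < c" "c < 1 / 2"
    and eta_def: "\<eta> = c / L"
    and prox_nonempty: "\<And>x. prox \<eta> r x \<noteq> {}"
    and c1_def: "c1 = (2 * c * (1 - 2 * c) + 2) / (c * (1 - 2 * c))"
    and c2_def: "c2 = (6 - 4 * c) / (1 - 2 * c)"
    and T_def: "\<And>e. T e = nat \<lceil>2 * c2 * \<Delta> / (\<eta> * e\<^sup>2)\<rceil>"
    and m_def: "\<And>e. m e = nat \<lceil>2 * c1 * \<sigma>\<^sup>2 / e\<^sup>2\<rceil>"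
    and eps_pos: "\<epsilon> > 0"
    and run: "mb_spg M D grad_fs r \<eta> x0 (T \<epsilon>) (\<lambda>_. m \<epsilon>) \<xi> x R"
  shows "upper_expectation M (\<lambda>\<omega>. (dist_zero (frechet_subdiff F (x (R \<omega>) \<omega>)))\<^sup>2) \<le> ennreal (\<epsilon>\<^sup>2)
    \<and> upper_expectation M (\<lambda>\<omega>. dist_zero (frechet_subdiff F (x (R \<omega>) \<omega>))) \<le> ennreal \<epsilon>
    \<and> (\<lambda>e. real (T e)) \<in> O[at_right 0](\<lambda>e. 1 / e\<^sup>2)
    \<and> (\<lambda>e. real (\<Sum>t<T e. m e)) \<in> O[at_right 0](\<lambda>e. 1 / e ^ 4)"
proof -
  interpret mb_spg M D grad_fs r \<eta> x0 "T \<epsilon>" "\<lambda>_. m \<epsilon>" \<xi> x R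
    by (rule run)
  define N where "N = T \<epsilon>"
  define n where "n = m \<epsilon>"

  \<comment> \<open>Signs of the constants and the two error budgets\<close>
  have c: "0 < 1 - 2 * c" using c_range by simp
  have \<eta>: "\<eta> > 0" using c_range L_pos eta_def by simp
  have c1: "c1 > 0" unfolding c1_def using c c_range
    by (intro divide_pos_pos add_nonneg_pos mult_pos_pos mult_nonneg_nonneg) auto
  have c2: "c2 > 0" unfolding c2_def using c c_range by (intro divide_pos_pos) auto
  have T_arg: "2 * c2 * \<Delta> / (\<eta> * \<epsilon>\<^sup>2) > 0"
    using c2 Delta_pos \<eta> eps_pos by simp
  have m_arg: "2 * c1 * \<sigma>\<^sup>2 / \<epsilon>\<^sup>2 > 0"
    using c1 sigma_pos eps_pos by simp
  have N: "N > 0" "2 * c2 * \<Delta> / (\<eta> * \<epsilon>\<^sup>2) \<le> real N"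
    using T_arg unfolding N_def T_def by (auto simp: real_nat_ceiling_ge)
  have n: "n > 0" "2 * c1 * \<sigma>\<^sup>2 / \<epsilon>\<^sup>2 \<le> real n"
    using m_arg unfolding n_def m_def by (auto simp: real_nat_ceiling_ge)
  \<comment> \<open>The factor 2 in both \<open>T\<close> and \<open>m\<close> splits the target
    \<open>real N * \<epsilon>\<^sup>2\<close> evenly between the initial gap and the accumulated
    gradient noise.\<close>
  have gap_budget: "c2 / \<eta> * \<Delta> \<le> real N * \<epsilon>\<^sup>2 / 2"
    using N(2) \<eta> eps_pos by (simp add: field_simps)
  have noise_budget: "c1 * (\<sigma>\<^sup>2 / real n) \<le> \<epsilon>\<^sup>2 / 2"
    using n eps_pos by (simp add: field_simps)

  \<comment> \<open>Finiteness of \<open>r\<close> along the run and the pathwise bound\<close>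
  have r_ninf: "r y \<noteq> -\<infinity>" for y using r_proper by (simp add: proper_def)
  \<comment> \<open>Finiteness of \<open>r\<close> passes from some \<open>y0\<close> to
    \<open>xstar\<close> by minimality, and from there to \<open>x0\<close> by the finite initial
    gap.\<close>
  obtain y0 where "r y0 \<noteq> \<infinity>" using r_proper by (auto simp: proper_def)
  then have "r xstar \<noteq> \<infinity>"
    using minimizer[of y0] r_ninf[of y0] by (cases "r y0") (auto simp: F_def)
  then obtain rs where rs: "r xstar = ereal rs"
    using r_ninf[of xstar] by (cases "r xstar") auto
  obtain r0 where r0: "r x0 = ereal r0"
    using initial_gap r_ninf[of x0] by (cases "r x0") (auto simp: F_def rs)
  \<comment> \<open>Real values of \<open>r\<close> on the iterates: finite at time 0 by the gap
    assumption, later because each iterate is a proximal point. Thus \<open>G\<close> below is a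
    real version of \<open>F\<close> on which differences telescope.\<close>
  define \<rho> where "\<rho> t \<omega> = real_of_ereal (r (x t \<omega>))" for t \<omega>
  have \<rho>: "r (x t \<omega>) = ereal (\<rho> t \<omega>)" if "t \<le> N" "\<omega> \<in> space M" for t \<omega>
  proof (cases t)
    case 0
    then show ?thesis using init[OF that(2)] by (simp add: \<rho>_def r0)
  next
    case (Suc s)
    then show ?thesis
      using prox_finite[OF r_proper step[of s \<omega>]] that by (auto simp: \<rho>_def N_def ereal_real)
  qed
  define V where "V t \<omega> = grad_f (x (Suc t) \<omega>)
    - (1 / \<eta>) *\<^sub>R (x (Suc t) \<omega> - (x t \<omega> - \<eta> *\<^sub>R stoch_grad t \<omega>))" for t \<omega>
  define e where "e t \<omega> = (norm (stoch_grad t \<omega> - grad_f (x t \<omega>)))\<^sup>2" for t \<omega>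
  define G where "G t \<omega> = f (x t \<omega>) + \<rho> t \<omega>" for t \<omega>
  have prox_step: "x (Suc t) \<omega> \<in> prox \<eta> r (x t \<omega> - \<eta> *\<^sub>R stoch_grad t \<omega>)"
    if "t < N" "\<omega> \<in> space M" for t \<omega>
    using step that by (simp add: stoch_grad_def N_def)
  have V_subdiff: "V t \<omega> \<in> frechet_subdiff F (x (Suc t) \<omega>)" if "t < N" "\<omega> \<in> space M" for t \<omega>
    unfolding V_def by (rule frechet_subdiff_prox[OF f_gradient r_proper prox_step[OF that] F_def])
  have V_step: "(norm (V t \<omega>))\<^sup>2 \<le> c1 * e t \<omega> + c2 / \<eta> * (G t \<omega> - G (Suc t) \<omega>)"
    if "t < N" "\<omega> \<in> space M" for t \<omega>
    using proximal_step_bound[OF f_gradient smooth r_proper L_pos c_range eta_def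
        prox_step[OF that] \<rho> \<rho>] that
    by (simp add: V_def e_def G_def c1_def c2_def)
  have V_sum: "(\<Sum>t<N. (norm (V t \<omega>))\<^sup>2) \<le> c1 * (\<Sum>t<N. e t \<omega>) + c2 / \<eta> * \<Delta>"
    if "\<omega> \<in> space M" for \<omega>
  proof -
    have "(\<Sum>t<N. (norm (V t \<omega>))\<^sup>2) \<le> (\<Sum>t<N. c1 * e t \<omega> + c2 / \<eta> * (G t \<omega> - G (Suc t) \<omega>))"
      using V_step that by (intro sum_mono) auto
    also have "\<dots> = c1 * (\<Sum>t<N. e t \<omega>) + c2 / \<eta> * (G 0 \<omega> - G N \<omega>)"
      by (simp only: sum.distrib sum_distrib_left[symmetric] sum_lessThan_telescope'[of "\<lambda>t. G t \<omega>"])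
    finally have "(\<Sum>t<N. (norm (V t \<omega>))\<^sup>2) \<le> c1 * (\<Sum>t<N. e t \<omega>) + c2 / \<eta> * (G 0 \<omega> - G N \<omega>)" .
    \<comment> \<open>The last iterate cannot fall below the minimum \<open>F xstar\<close>, so the
      total decrease is bounded on every path, not only in mean.\<close>
    moreover have "G 0 \<omega> - G N \<omega> \<le> \<Delta>"
    proof -
      have "G 0 \<omega> = f x0 + r0"
        using init[OF that] by (simp add: G_def \<rho>_def r0)
      moreover have "f xstar + rs \<le> G N \<omega>"
        using minimizer[of "x N \<omega>"] \<rho>[OF order_refl that] by (simp add: F_def rs G_def)
      ultimately show ?thesis
        using initial_gap by (simp add: F_def rs r0)
    qed
    then have "c2 / \<eta> * (G 0 \<omega> - G N \<omega>) \<le> c2 / \<eta> * \<Delta>"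
      using c2 \<eta> by (intro mult_left_mono) auto
    ultimately show ?thesis by linarith
  qed

  \<comment> \<open>Measurability of the subgradients and the mean gradient error\<close>
  have joint: "(\<lambda>(y, s). grad_fs y s) \<in> borel_measurable (borel \<Otimes>\<^sub>M D)"
    by (rule gradient_jointly_measurable[OF borel_measurable_integrable[OF f_integrable] fs_gradient])
  have "continuous_on UNIV grad_f"
    by (rule lipschitz_on_continuous_on[of L])
      (use smooth L_pos in \<open>auto intro!: lipschitz_onI simp: dist_norm\<close>)
  then have grad_f [measurable]: "grad_f \<in> borel_measurable borel"
    by (rule borel_measurable_continuous_onI)
  have x_past: "x t \<in> borel_measurable (past N)" if "t \<le> N" for t
    using that by (rule iterate_past_measurable)
  have g_past: "stoch_grad t \<in> borel_measurable (past N)" if "t < N" for t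
    using that joint by (intro stoch_grad_past_measurable) (auto simp: N_def)
  \<comment> \<open>Measurability over \<open>M\<close> would be too weak: the output index is
    independent only of events in the history.\<close>
  have V_past: "V t \<in> borel_measurable (past N)" if "t < N" for t
  proof -
    have [measurable]: "x t \<in> borel_measurable (past N)" "x (Suc t) \<in> borel_measurable (past N)"
      "stoch_grad t \<in> borel_measurable (past N)"
      using that by (auto intro: x_past g_past)
    show ?thesis unfolding V_def by measurable
  qed
  have e_meas: "(\<lambda>\<omega>. e t \<omega>) \<in> borel_measurable M" if "t < N" for t
  proof -
    have [measurable]: "x t \<in> borel_measurable (past N)" "stoch_grad t \<in> borel_measurable (past N)"
      using that by (auto intro: x_past g_past)
    have "(\<lambda>\<omega>. e t \<omega>) \<in> borel_measurable (past N)" unfolding e_def by measurable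
    then show ?thesis
      using measurable_from_subalg[OF subalgebra_past] by (simp add: N_def)
  qed
  have e_mean: "(\<integral>\<^sup>+\<omega>. ennreal (e t \<omega>) \<partial>M) \<le> ennreal (\<sigma>\<^sup>2 / real n)" if "t < N" for t
    unfolding e_def n_def using that n(1) unbiased variance joint
    by (intro stoch_grad_variance) (auto simp: N_def n_def)

  \<comment> \<open>The mean of the squared subgradient norms\<close>
  have "(\<Sum>t<N. \<integral>\<^sup>+\<omega>. ennreal ((norm (V t \<omega>))\<^sup>2) \<partial>M)
      = (\<integral>\<^sup>+\<omega>. (\<Sum>t<N. ennreal ((norm (V t \<omega>))\<^sup>2)) \<partial>M)"
    using measurable_from_subalg[OF subalgebra_past V_past[unfolded N_def]]
    by (intro nn_integral_sum[symmetric]) (auto simp: N_def)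
  \<comment> \<open>The telescoped bound is integrated path by path; its gap term is deterministic,
    which leaves only the gradient errors to average.\<close>
  also have "\<dots> \<le> (\<integral>\<^sup>+\<omega>. ennreal c1 * (\<Sum>t<N. ennreal (e t \<omega>)) + ennreal (c2 / \<eta> * \<Delta>) \<partial>M)"
  proof (rule nn_integral_mono)
    fix \<omega> assume "\<omega> \<in> space M"
    have "(\<Sum>t<N. ennreal ((norm (V t \<omega>))\<^sup>2)) \<le> ennreal (c1 * (\<Sum>t<N. e t \<omega>) + c2 / \<eta> * \<Delta>)"
      using V_sum[OF \<open>\<omega> \<in> space M\<close>] by (simp add: ennreal_leI)
    also have "\<dots> = ennreal c1 * (\<Sum>t<N. ennreal (e t \<omega>)) + ennreal (c2 / \<eta> * \<Delta>)"
      using c1 c2 \<eta> Delta_pos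
      by (subst ennreal_plus) (auto simp: e_def sum_nonneg ennreal_mult)
    finally show "(\<Sum>t<N. ennreal ((norm (V t \<omega>))\<^sup>2))
        \<le> ennreal c1 * (\<Sum>t<N. ennreal (e t \<omega>)) + ennreal (c2 / \<eta> * \<Delta>)" .
  qed
  also have "\<dots> = ennreal c1 * (\<Sum>t<N. \<integral>\<^sup>+\<omega>. ennreal (e t \<omega>) \<partial>M) + ennreal (c2 / \<eta> * \<Delta>)"
  proof -
    have [measurable]: "(\<lambda>\<omega>. ennreal (e t \<omega>)) \<in> borel_measurable M" if "t \<in> {..<N}" for t
      using measurable_compose[OF e_meas measurable_ennreal] that by simp
    show ?thesis
      by (simp add: nn_integral_add nn_integral_cmult nn_integral_sum[symmetric] emeasure_space_1)
  qed
  also have "\<dots> \<le> ennreal c1 * (\<Sum>t<N. ennreal (\<sigma>\<^sup>2 / real n)) + ennreal (c2 / \<eta> * \<Delta>)"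
    using e_mean by (intro add_right_mono mult_left_mono sum_mono) auto
  also have "\<dots> = ennreal (real N * (c1 * (\<sigma>\<^sup>2 / real n)) + c2 / \<eta> * \<Delta>)"
    using c1 c2 \<eta> Delta_pos
    by (subst ennreal_plus)
      (auto simp: ennreal_mult[symmetric] ennreal_of_nat_eq_real_of_nat mult_ac)
  also have "\<dots> \<le> ennreal (real N * \<epsilon>\<^sup>2)"
  proof (rule ennreal_leI)
    have "real N * (c1 * (\<sigma>\<^sup>2 / real n)) \<le> real N * (\<epsilon>\<^sup>2 / 2)"
      using noise_budget by (rule mult_left_mono) simp
    then show "real N * (c1 * (\<sigma>\<^sup>2 / real n)) + c2 / \<eta> * \<Delta> \<le> real N * \<epsilon>\<^sup>2"
      using gap_budget by linarith
  qed
  finally have mean: "(\<Sum>t<N. \<integral>\<^sup>+\<omega>. ennreal ((norm (V t \<omega>))\<^sup>2) \<partial>M) \<le> ennreal (real N * \<epsilon>\<^sup>2)" .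
  note dist = upper_expectation_dist_output[of \<epsilon> V F, folded N_def,
      OF N(1) eps_pos V_past V_subdiff mean]

  \<comment> \<open>Growth of the iteration and sample counts as the accuracy tends to 0\<close>
  have T_bigo: "(\<lambda>e. real (T e)) \<in> O[at_right 0](\<lambda>e. 1 / e\<^sup>2)"
    using nat_ceiling_inverse_square_bigo[of "2 * c2 * \<Delta> / \<eta>"] c2 Delta_pos \<eta>
    by (simp add: T_def)
  have m_bigo: "(\<lambda>e. real (m e)) \<in> O[at_right 0](\<lambda>e. 1 / e\<^sup>2)"
    using nat_ceiling_inverse_square_bigo[of "2 * c1 * \<sigma>\<^sup>2"] c1
    by (simp add: m_def)
  have "(\<lambda>e. real (\<Sum>t<T e. m e)) \<in> O[at_right 0](\<lambda>e. 1 / e ^ 4)"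
    using landau_o.big.mult[OF T_bigo m_bigo] by (simp flip: power_add)
  with dist T_bigo show ?thesis by blast
qed

end
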